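(* Let $d\in\Omega$. Then $d$ is predictable if and only if $d$ is a box metric.
   Context: A norm-derived metric on $\mathbb{R}^2$ is a metric $d(\mathbf{x},\mathbf{y})=\|\mathbf{x}-\mathbf{y}\|$ for a norm $\|\cdot\|$; its shape is the unit ball $P=\{\mathbf{x}:\|\mathbf{x}\|\le1\}$. It is polygonal if its shape is a polygon and smooth if its shape is bounded by a smooth curve. $\Omega$ is the set of norm-derived metrics on $\mathbb{R}^2$ that are polygonal or smooth. A box metric is one whose shape is a parallelogram. For a countably infinite set $V\subseteq\mathbb{R}^2$ and $p\in(0,1)$, the random graph $\mathrm{LARG}(V,p)$ has vertex set $V$, and for each pair of distinct vertices $\mathbf{u},\mathbf{v}$ with $d(\mathbf{u},\mathbf{v})<1$ an edge is added independently with probability $p$ (pairs at distance $\ge1$ are never adjacent). The metric $d$ is predictable if there exists a countable dense set $V\subseteq\mathbb{R}^2$ such that for all $p\in(0,1)$, with probability $1$ any two graphs generated independently by $\mathrm{LARG}(V,p)$ are isomorphic. *)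

theory Defs
  imports "HOL-Probability.Probability"
begin

definition is_norm :: "(real^2 \<Rightarrow> real) \<Rightarrow> bool" where
  "is_norm N \<longleftrightarrow>
     (\<forall>x. N x \<ge> 0) \<and>
     (\<forall>x. N x = 0 \<longleftrightarrow> x = 0) \<and>
     (\<forall>a x. N (a *\<^sub>R x) = \<bar>a\<bar> * N x) \<and>
     (\<forall>x y. N (x + y) \<le> N x + N y)"

definition norm_derived :: "(real^2 \<Rightarrow> real^2 \<Rightarrow> real) \<Rightarrow> bool" where
  "norm_derived d \<longleftrightarrow> (\<exists>N. is_norm N \<and> (\<forall>x y. d x y = N (x - y)))"

text \<open>For a norm-derived metric \<open>d x 0\<close> is the norm of \<open>x\<close>, so this is the closed unit ball.\<close>

definition shape :: "(real^2 \<Rightarrow> real^2 \<Rightarrow> real) \<Rightarrow> (real^2) set" where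
  "shape d = {x. d x 0 \<le> 1}"

text \<open>Only convex polygons (as filled regions) are needed, because unit balls of norms are convex.\<close>

definition convex_polygon :: "(real^2) set \<Rightarrow> bool" where
  "convex_polygon S \<longleftrightarrow> polytope S \<and> aff_dim S = 2"

text \<open>A smooth closed curve is the image of a simple closed curve that is continuously
  differentiable with nowhere vanishing velocity. It is parametrised by a function of period 1 on
  the whole line, so that no corner is possible at the point where the curve closes up.\<close>

definition smooth_closed_curve :: "(real^2) set \<Rightarrow> bool" where
  "smooth_closed_curve C \<longleftrightarrow>
     (\<exists>\<gamma> :: real \<Rightarrow> real^2.
        \<gamma> C1_differentiable_on UNIV \<and>
        (\<forall>t. vector_derivative \<gamma> (at t) \<noteq> 0) \<and>
        (\<forall>t. \<gamma> (t + 1) = \<gamma> t) \<and>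
        inj_on \<gamma> {0..<1} \<and>
        range \<gamma> = C)"

definition parallelogram :: "(real^2) set \<Rightarrow> bool" where
  "parallelogram S \<longleftrightarrow>
     (\<exists>a u v. \<not> collinear {0, u, v} \<and> S = convex hull {a, a + u, a + u + v, a + v})"

definition polygonal :: "(real^2 \<Rightarrow> real^2 \<Rightarrow> real) \<Rightarrow> bool" where
  "polygonal d \<longleftrightarrow> convex_polygon (shape d)"

definition smooth :: "(real^2 \<Rightarrow> real^2 \<Rightarrow> real) \<Rightarrow> bool" where
  "smooth d \<longleftrightarrow> smooth_closed_curve (frontier (shape d))"

definition Omega :: "(real^2 \<Rightarrow> real^2 \<Rightarrow> real) set" where
  "Omega = {d. norm_derived d \<and> (polygonal d \<or> smooth d)}"

definition box_metric :: "(real^2 \<Rightarrow> real^2 \<Rightarrow> real) \<Rightarrow> bool" where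
  "box_metric d \<longleftrightarrow> norm_derived d \<and> parallelogram (shape d)"

text \<open>A simple graph is a pair of a vertex set and a set of two-element edges.\<close>

type_synonym 'a graph = "'a set \<times> 'a set set"

definition graph_isomorphic :: "'a graph \<Rightarrow> 'b graph \<Rightarrow> bool" where
  "graph_isomorphic G H \<longleftrightarrow>
     (\<exists>f. bij_betw f (fst G) (fst H) \<and>
          (\<forall>u\<in>fst G. \<forall>v\<in>fst G. {u, v} \<in> snd G \<longleftrightarrow> {f u, f v} \<in> snd H))"

definition close_pairs :: "('a \<Rightarrow> 'a \<Rightarrow> real) \<Rightarrow> 'a set \<Rightarrow> 'a set set" where
  "close_pairs d V = {{u, v} | u v. u \<in> V \<and> v \<in> V \<and> u \<noteq> v \<and> d u v < 1}"

text \<open>The random graph \<open>LARG(V, p)\<close> is the random variable \<open>larg_graph d V\<close> on the probability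
  space \<open>larg d V p\<close> of independent coin flips, one for each unordered pair of distinct vertices
  at distance less than 1.\<close>

definition larg :: "('a \<Rightarrow> 'a \<Rightarrow> real) \<Rightarrow> 'a set \<Rightarrow> real \<Rightarrow> ('a set \<Rightarrow> bool) measure" where
  "larg d V p = PiM (close_pairs d V) (\<lambda>_. measure_pmf (bernoulli_pmf p))"

definition larg_graph :: "('a \<Rightarrow> 'a \<Rightarrow> real) \<Rightarrow> 'a set \<Rightarrow> ('a set \<Rightarrow> bool) \<Rightarrow> 'a graph" where
  "larg_graph d V \<omega> = (V, {e \<in> close_pairs d V. \<omega> e})"

lemma prob_space_larg: "prob_space (larg d V p)"
  unfolding larg_def by (intro prob_space_PiM measure_pmf.prob_space_axioms)

text \<open>Two independent samples are one sample of the product measure. The quantifier \<open>AE\<close> only asks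
  that the exceptional set lie in a null set: the set of pairs of isomorphic graphs need not be
  measurable, so probability 1 is meant with respect to the completed measure.\<close>

definition predictable :: "(real^2 \<Rightarrow> real^2 \<Rightarrow> real) \<Rightarrow> bool" where
  "predictable d \<longleftrightarrow>
     (\<exists>V. countable V \<and> closure V = UNIV \<and>
        (\<forall>p\<in>{0<..<1}.
           AE (\<omega>1, \<omega>2) in larg d V p \<Otimes>\<^sub>M larg d V p.
             graph_isomorphic (larg_graph d V \<omega>1) (larg_graph d V \<omega>2)))"

end

(* Box metric: take V countable and dense with no integer coordinate differences.  Almost surely both
   graphs realise every finite adjacency pattern arbitrarily close to any point where it is
   geometrically possible, and a back-and-forth argument that preserves the integer parts of all
   coordinate differences builds an isomorphism.

   Conversely, an isomorphism f between two such graphs preserves "distance < k" for all k >= 2.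
   Rescaling f at infinity gives an isometry U.  If the norm has gradients c at u and c' at U u, then
   comparing distances to far away points in direction u shows that c x > c x' + j implies
   c' (f x) >= c' (f x') + j for integers j.  Unless the unit ball is a parallelogram, there are three
   pairwise independent c of this kind, and their linear relation becomes a Pexider equation
   whose solutions at bounded distance from the identity are translations.  So f is affine.  This leaves
   countably many f, and each one is an isomorphism with probability 0. *)

theory Submission
  imports Defs
begin

section \<open>Adjacency patterns in random graphs\<close>

text \<open>Almost surely the graph shows distances only through integer thresholds: a pair at
  distance < 1 may be a nonedge, while for k >= 2 "distance < k" means that a walk with k edges
  exists. A priori an isomorphism is thus a bijection with bounded additive distortion and no
  continuity. There are uncountably many such maps, so null sets cannot simply be united over them.
  The lost precision is recovered at infinity: a distant point can be placed so that its distance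
  from x lies just below an integer, and then integer thresholds detect arbitrarily small
  differences of c. Two functionals yield two monotone relations that are not tied to each other,
  which is the freedom that the back-and-forth argument exploits for a box; a third functional ties
  them together. In the box case "distance < 1" alone would not be a sufficient invariant: the
  conditions that two old points impose on a new one are compatible only because of an inequality
  with an arbitrary integer bound.\<close>

lemma AE_PiM_bernoulli_pattern:
  fixes J :: "nat \<Rightarrow> 'i set" and b :: "'i \<Rightarrow> bool"
  assumes p: "0 < p" "p < 1"
    and J: "disjoint_family J" "\<And>k. J k \<subseteq> I" "\<And>k. finite (J k)" "\<And>k. card (J k) \<le> m"
  shows "AE \<omega> in PiM I (\<lambda>_. measure_pmf (bernoulli_pmf p)). \<exists>k. \<forall>i\<in>J k. \<omega> i = b i"
proof -
  define M where "M = PiM I (\<lambda>_. measure_pmf (bernoulli_pmf p))"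
  interpret product_prob_space "\<lambda>_::'i. measure_pmf (bernoulli_pmf p)" I
    by unfold_locales
  interpret M: prob_space M
    unfolding M_def by (rule P.prob_space_axioms)
  \<comment> \<open>A lower bound for the probability of either value of a coin, so every pattern on
    at most m coins has probability at least \<open>q ^ m\<close>, uniformly in k.\<close>
  define q where "q = min p (1 - p)"
  have q: "0 < q" "q < 1" using p by (auto simp: q_def)
  define E where "E k = {\<omega>\<in>space M. \<forall>i\<in>J k. \<omega> i = b i}" for k
  have E_eq: "E k = {\<omega>\<in>space M. \<forall>i\<in>J k. \<omega> i \<in> {b i}}" for k by (simp add: E_def)
  have E_sets [measurable]: "E k \<in> sets M" for k
  proof -
    have "{\<omega>\<in>space M. \<omega> i = b i} \<in> sets M" if "i \<in> J k" for i
    proof -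
      have "i \<in> I" using that J(2) by auto
      then show ?thesis unfolding M_def by measurable
    qed
    then show ?thesis
      unfolding E_def using J(3) by (intro sets.sets_Collect_finite_All) auto
  qed
  have prob_E: "q ^ m \<le> M.prob (E k)" for k
  proof -
    have "emeasure M (E k) = (\<Prod>i\<in>J k. emeasure (measure_pmf (bernoulli_pmf p)) {b i})"
      unfolding E_eq M_def by (rule emeasure_PiM_Collect) (use J in auto)
    also have "\<dots> = (\<Prod>i\<in>J k. ennreal (pmf (bernoulli_pmf p) (b i)))"
      by (simp add: emeasure_pmf_single)
    also have "\<dots> = ennreal (\<Prod>i\<in>J k. pmf (bernoulli_pmf p) (b i))"
      by (simp add: prod_ennreal)
    finally have "M.prob (E k) = (\<Prod>i\<in>J k. pmf (bernoulli_pmf p) (b i))"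
      by (simp add: measure_def prod_nonneg)
    moreover have "pmf (bernoulli_pmf p) c \<ge> q" for c
      using p by (cases c) (auto simp: q_def)
    then have "(\<Prod>i\<in>J k. q) \<le> (\<Prod>i\<in>J k. pmf (bernoulli_pmf p) (b i))"
      using q by (intro prod_mono) auto
    moreover have "q ^ m \<le> q ^ card (J k)"
      using q J(4) by (intro power_decreasing) auto
    ultimately show ?thesis by simp
  qed
  have ind: "M.indep_vars (\<lambda>_. measure_pmf (bernoulli_pmf p)) (\<lambda>i \<omega>. \<omega> i) I"
  proof (cases "I = {}")
    case True
    then show ?thesis by (simp add: M.indep_vars_def M.indep_sets_def)
  next
    case False
    then show ?thesis
    proof (subst M.indep_vars_iff_distr_eq_PiM')
    show "distr M (\<Pi>\<^sub>M i\<in>I. measure_pmf (bernoulli_pmf p)) (\<lambda>x. \<lambda>i\<in>I. x i) =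
      (\<Pi>\<^sub>M i\<in>I. distr M (measure_pmf (bernoulli_pmf p)) (\<lambda>\<omega>. \<omega> i))"
    proof -
      have "distr M (\<Pi>\<^sub>M i\<in>I. measure_pmf (bernoulli_pmf p)) (\<lambda>x. \<lambda>i\<in>I. x i) = distr M M (\<lambda>x. x)"
        unfolding M_def by (intro distr_cong) (auto simp: space_PiM PiE_def extensional_restrict)
      also have "\<dots> = M" by (rule distr_id)
      also have "M = (\<Pi>\<^sub>M i\<in>I. distr M (measure_pmf (bernoulli_pmf p)) (\<lambda>\<omega>. \<omega> i))"
        unfolding M_def by (intro PiM_cong) (auto simp: PiM_component)
      finally show ?thesis .
    qed
    qed (auto simp: M_def)
  qed
  have "M.indep_vars (\<lambda>k. PiM (J k) (\<lambda>_. measure_pmf (bernoulli_pmf p)))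
      (\<lambda>k \<omega>. restrict (\<lambda>i. \<omega> i) (J k)) UNIV"
    using J by (intro M.indep_vars_restrict[OF ind]) auto
  then have "M.indep_events (\<lambda>k. {\<omega>\<in>space M. \<not> (\<forall>i\<in>J k. restrict \<omega> (J k) i = b i)}) UNIV"
  proof (rule M.indep_eventsI_indep_vars)
    fix k
    have "{x \<in> space (PiM (J k) (\<lambda>_. measure_pmf (bernoulli_pmf p))). \<forall>i\<in>J k. x i = b i}
        \<in> sets (PiM (J k) (\<lambda>_. measure_pmf (bernoulli_pmf p)))"
      using J(3) by (intro sets.sets_Collect_finite_All) auto
    then show "{x \<in> space (PiM (J k) (\<lambda>_. measure_pmf (bernoulli_pmf p))). \<not> (\<forall>i\<in>J k. x i = b i)}
        \<in> sets (PiM (J k) (\<lambda>_. measure_pmf (bernoulli_pmf p)))"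
      by (rule sets.sets_Collect_neg)
  qed
  also have "(\<lambda>k. {\<omega>\<in>space M. \<not> (\<forall>i\<in>J k. restrict \<omega> (J k) i = b i)}) = (\<lambda>k. space M - E k)"
    by (auto simp: E_def fun_eq_iff)
  finally have indep: "M.indep_events (\<lambda>k. space M - E k) UNIV" .
  \<comment> \<open>Disjoint coin sets make the failures independent, and the common bound m on
    their sizes bounds every factor by the same number below 1.\<close>
  have bound: "M.prob (\<Inter>k. space M - E k) \<le> (1 - q ^ m) ^ Suc n" for n
  proof -
    have "M.prob (\<Inter>k. space M - E k) \<le> M.prob (\<Inter>k\<in>{..n}. space M - E k)"
      by (intro M.finite_measure_mono sets.finite_INT) auto
    also have "\<dots> = (\<Prod>k\<in>{..n}. M.prob (space M - E k))"
      using indep unfolding M.indep_events_def by (auto dest: spec[of _ "{..n}"])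
    also have "\<dots> = (\<Prod>k\<in>{..n}. 1 - M.prob (E k))"
      by (intro prod.cong refl M.prob_compl) auto
    also have "\<dots> \<le> (\<Prod>k\<in>{..n}. 1 - q ^ m)"
      using prob_E by (intro prod_mono) auto
    finally show ?thesis by simp
  qed
  have "(\<lambda>n. (1 - q ^ m) ^ Suc n) \<longlonglongrightarrow> 0"
    using q by (intro LIMSEQ_Suc LIMSEQ_power_zero) (auto simp: power_le_one)
  then have "M.prob (\<Inter>k. space M - E k) \<le> 0"
    by (rule LIMSEQ_le_const) (use bound in blast)
  then have "M.prob (\<Inter>k. space M - E k) = 0"
    by (simp add: measure_le_0_iff)
  then have "(\<Inter>k. space M - E k) \<in> null_sets M"
    by (intro null_setsI) (auto simp: M.emeasure_eq_measure)
  then have "AE \<omega> in M. \<exists>k. \<forall>i\<in>J k. \<omega> i = b i"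
    by (rule AE_I') (auto simp: E_def)
  then show ?thesis unfolding M_def .
qed

text \<open>Short for \<^emph>\<open>geometrically existentially closed\<close>.\<close>

definition gec :: "('a::topological_space \<Rightarrow> 'a \<Rightarrow> real) \<Rightarrow> 'a set \<Rightarrow> 'a set set \<Rightarrow> bool" where
  "gec d V E \<longleftrightarrow> (\<forall>A B W. finite A \<longrightarrow> finite B \<longrightarrow> A \<subseteq> V \<longrightarrow> B \<subseteq> V \<longrightarrow> A \<inter> B = {} \<longrightarrow>
     open W \<longrightarrow> W \<noteq> {} \<longrightarrow> (\<forall>z\<in>W. \<forall>a\<in>A \<union> B. d z a < 1) \<longrightarrow>
     (\<exists>z\<in>W \<inter> V. z \<notin> A \<union> B \<and> (\<forall>a\<in>A. {z, a} \<in> E) \<and> (\<forall>b\<in>B. {z, b} \<notin> E)))"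

lemma close_pairsI: "\<lbrakk>u \<in> V; v \<in> V; u \<noteq> v; d u v < 1\<rbrakk> \<Longrightarrow> {u, v} \<in> close_pairs d V"
  by (auto simp: close_pairs_def)

text \<open>Nonempty open sets are infinite, so removing finitely many points leaves a nonempty open
  set, which must meet V again.\<close>

lemma infinite_dense_inter_open:
  fixes V :: "'a::euclidean_space set"
  assumes "closure V = UNIV" "open W" "W \<noteq> {}"
  shows "infinite (W \<inter> V)"
proof
  assume fin: "finite (W \<inter> V)"
  have "open (W - (W \<inter> V))" using assms fin by (intro open_Diff finite_imp_closed)
  moreover have "W - (W \<inter> V) \<noteq> {}"
  proof
    assume "W - (W \<inter> V) = {}"
    then have "W \<inter> V = W" by auto
    then show False using finite_imp_not_open[of W] assms fin by simp
  qed
  ultimately have "(W - (W \<inter> V)) \<inter> V \<noteq> {}"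
    using open_Int_closure_eq_empty[of "W - (W \<inter> V)" V] assms(1) by simp
  then show False by auto
qed

text \<open>Restricting W to a countable base leaves countably many instances, so it suffices to
  treat one. For fixed A, B, W each candidate z in W brings its own coins towards A and B; these
  coin sets are disjoint, of bounded size and infinite in number, so one of them shows the required
  pattern.\<close>

lemma AE_larg_gec:
  fixes d :: "'a::euclidean_space \<Rightarrow> 'a \<Rightarrow> real"
  assumes p: "0 < p" "p < 1" and V: "countable V" "closure V = UNIV"
  shows "AE \<omega> in larg d V p. gec d V (snd (larg_graph d V \<omega>))"
proof -
  obtain \<B> :: "'a set set" where \<B>: "countable \<B>" "topological_basis \<B>"
    using ex_countable_basis by metis
  define T where "T = {(A, B, W). finite A \<and> finite B \<and> A \<subseteq> V \<and> B \<subseteq> V \<and> A \<inter> B = {} \<and>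
     W \<in> \<B> \<and> W \<noteq> {} \<and> (\<forall>z\<in>W. \<forall>a\<in>A \<union> B. d z a < 1)}"
  let ?E = "\<lambda>\<omega>. snd (larg_graph d V \<omega>)"
  have "countable T"
  proof (rule countable_subset)
    show "T \<subseteq> {A. finite A \<and> A \<subseteq> V} \<times> {A. finite A \<and> A \<subseteq> V} \<times> \<B>" by (auto simp: T_def)
    show "countable ({A. finite A \<and> A \<subseteq> V} \<times> {A. finite A \<and> A \<subseteq> V} \<times> \<B>)"
      using V \<B> by (intro countable_SIGMA countable_Collect_finite_subset)
  qed
  have one: "AE \<omega> in larg d V p. \<exists>z\<in>W \<inter> V. z \<notin> A \<union> B \<and> (\<forall>a\<in>A. {z, a} \<in> ?E \<omega>) \<and> (\<forall>b\<in>B. {z, b} \<notin> ?E \<omega>)"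
    if "(A, B, W) \<in> T" for A B W
  proof -
    have fin: "finite A" "finite B" and AB: "A \<subseteq> V" "B \<subseteq> V" "A \<inter> B = {}"
      and W: "W \<in> \<B>" "W \<noteq> {}" "\<forall>z\<in>W. \<forall>a\<in>A \<union> B. d z a < 1"
      using that by (auto simp: T_def)
    have "infinite (W \<inter> V - (A \<union> B))"
      using infinite_dense_inter_open[OF V(2) _ W(2)] W(1) \<B>(2) fin
      by (simp add: topological_basis_open)
    then obtain z :: "nat \<Rightarrow> 'a" where z: "inj z" "range z \<subseteq> W \<inter> V - (A \<union> B)"
      using infinite_countable_subset by blast
    define J where "J k = (\<lambda>a. {z k, a}) ` (A \<union> B)" for k
    \<comment> \<open>The value prescribed for the coin \<open>{z k, a}\<close> is true exactly for
      a in A: neither \<open>z k\<close> nor, by disjointness, a member of B belongs to A.\<close>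
    have "AE \<omega> in larg d V p. \<exists>k. \<forall>i\<in>J k. \<omega> i = (\<exists>a\<in>A. a \<in> i)"
      unfolding larg_def
    proof (rule AE_PiM_bernoulli_pattern[OF p])
      show "disjoint_family J"
        unfolding disjoint_family_on_def
      proof (intro ballI impI)
        fix m n :: nat assume "m \<noteq> n"
        then have "z m \<noteq> z n" using z(1) by (simp add: inj_eq)
        moreover have "z m \<notin> A \<union> B" "z n \<notin> A \<union> B" using z(2) by auto
        ultimately show "J m \<inter> J n = {}"
          unfolding J_def by (force simp: doubleton_eq_iff)
      qed
      show "J k \<subseteq> close_pairs d V" for k
        using z(2) W(3) AB unfolding J_def by (auto intro!: close_pairsI)
      show "finite (J k)" for k using fin by (simp add: J_def)
      show "card (J k) \<le> card (A \<union> B)" for k using fin by (simp add: J_def card_image_le)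
    qed
    then show ?thesis
    proof eventually_elim
      case (elim \<omega>)
      then obtain k where k: "\<forall>i\<in>J k. \<omega> i = (\<exists>a\<in>A. a \<in> i)" by auto
      have zk: "z k \<in> W \<inter> V" "z k \<notin> A \<union> B" using z(2) by auto
      have cp: "{z k, a} \<in> close_pairs d V" if "a \<in> A \<union> B" for a
        using zk W(3) AB that by (intro close_pairsI) auto
      have val: "\<omega> {z k, a} \<longleftrightarrow> a \<in> A" if "a \<in> A \<union> B" for a
        using k zk(2) that unfolding J_def by auto
      show ?case
        using zk cp val AB(3) by (intro bexI[of _ "z k"]) (auto simp: larg_graph_def)
    qed
  qed
  have "AE \<omega> in larg d V p. \<forall>(A, B, W)\<in>T. \<exists>z\<in>W \<inter> V. z \<notin> A \<union> B \<and> (\<forall>a\<in>A. {z, a} \<in> ?E \<omega>) \<and> (\<forall>b\<in>B. {z, b} \<notin> ?E \<omega>)"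
    using one \<open>countable T\<close> by (subst AE_ball_countable) (auto split: prod.splits)
  then show ?thesis
  proof eventually_elim
    case (elim \<omega>)
    show ?case
      unfolding gec_def
    proof (intro allI impI)
      fix A B W assume *: "finite A" "finite B" "A \<subseteq> V" "B \<subseteq> V" "A \<inter> B = {}"
        "open W" "W \<noteq> {}" "\<forall>z\<in>W. \<forall>a\<in>A \<union> B. d z a < 1"
      obtain W' where W': "W' \<in> \<B>" "W' \<subseteq> W" "W' \<noteq> {}"
      proof -
        obtain x where "x \<in> W" using *(7) by auto
        with topological_basisE[OF \<B>(2) *(6)] that show ?thesis by (metis empty_iff)
      qed
      then have "(A, B, W') \<in> T" using * by (auto simp: T_def)
      from bspec[OF elim this] obtain z where "z \<in> W'" "z \<in> V" "z \<notin> A \<union> B"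
          "\<forall>a\<in>A. {z, a} \<in> ?E \<omega>" "\<forall>b\<in>B. {z, b} \<notin> ?E \<omega>"
        by auto
      with W'(2) show "\<exists>z\<in>W \<inter> V. z \<notin> A \<union> B \<and> (\<forall>a\<in>A. {z, a} \<in> ?E \<omega>) \<and> (\<forall>b\<in>B. {z, b} \<notin> ?E \<omega>)"
        by (intro bexI[of _ z]) auto
    qed
  qed
qed

text \<open>For a fixed sample \<open>\<omega>1\<close> an isomorphism \<open>f\<close> leaves only one possible value of each coordinate
  of \<open>\<omega>2\<close>.\<close>

lemma AE_larg_not_iso_via:
  assumes p: "0 < p" "p < 1" and inf: "infinite (close_pairs d V)"
    and f: "bij_betw f V V"
  shows "AE \<omega>2 in larg d V p. \<not> (\<forall>u\<in>V. \<forall>v\<in>V. {u, v} \<in> E \<longleftrightarrow> {f u, f v} \<in> snd (larg_graph d V \<omega>2))"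
proof -
  obtain e :: "nat \<Rightarrow> 'a set" where e: "inj e" "range e \<subseteq> close_pairs d V"
    using infinite_countable_subset[OF inf] by blast
  define g where "g = inv_into V f"
  \<comment> \<open>The pattern is the negation of the value that f forces on the coin
    \<open>e k\<close>, so a single coin that follows it refutes f.\<close>
  have "AE \<omega> in larg d V p. \<exists>k. \<forall>i\<in>{e k}. \<omega> i = (g ` i \<notin> E)"
    unfolding larg_def
    by (rule AE_PiM_bernoulli_pattern[OF p, where m = 1])
      (use e in \<open>auto simp: disjoint_family_on_def inj_eq\<close>)
  then show ?thesis
  proof eventually_elim
    case (elim \<omega>)
    then obtain k where k: "\<omega> (e k) = (g ` e k \<notin> E)" by auto
    obtain x y where xy: "e k = {x, y}" "x \<in> V" "y \<in> V"
      using e(2) unfolding close_pairs_def by blast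
    have "f (g x) = x" "f (g y) = y" "g x \<in> V" "g y \<in> V"
      using xy f unfolding g_def by (auto simp: bij_betw_def f_inv_into_f inv_into_into)
    moreover have "{x, y} \<in> close_pairs d V" using xy(1) e(2) by auto
    ultimately show ?case
    proof (intro notI)
      assume *: "\<forall>u\<in>V. \<forall>v\<in>V. {u, v} \<in> E \<longleftrightarrow> {f u, f v} \<in> snd (larg_graph d V \<omega>)"
      have "{g x, g y} \<in> E \<longleftrightarrow> {f (g x), f (g y)} \<in> snd (larg_graph d V \<omega>)"
        using * \<open>g x \<in> V\<close> \<open>g y \<in> V\<close> by simp
      also have "\<dots> \<longleftrightarrow> \<omega> {x, y}"
        using \<open>f (g x) = x\<close> \<open>f (g y) = y\<close> \<open>{x, y} \<in> close_pairs d V\<close> by (simp add: larg_graph_def)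
      finally show False using k xy(1) by simp
    qed
  qed
qed

section \<open>Norms in the plane and parallelograms\<close>

definition cross2 :: "real^2 \<Rightarrow> real^2 \<Rightarrow> real" where
  "cross2 u v = u$1 * v$2 - u$2 * v$1"

lemma cross2_scaleR: "cross2 (a *\<^sub>R u) (b *\<^sub>R v) = a * b * cross2 u v"
  by (simp add: cross2_def algebra_simps)

lemma inner_real2: "(x::real^2) \<bullet> y = x$1 * y$1 + x$2 * y$2"
  by (simp add: inner_vec_def sum_2)

lemma vec_eq_real2: "(x::real^2) = y \<longleftrightarrow> x$1 = y$1 \<and> x$2 = y$2"
  by (simp add: vec_eq_iff forall_2)

text \<open>Cramer's rule: with nonzero determinant, c1 and c2 serve as linear coordinates of the
  plane.\<close>

lemma cross2_nonzeroE:
  assumes "cross2 c1 c2 \<noteq> 0"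
  obtains x where "c1 \<bullet> x = s" "c2 \<bullet> x = t"
proof
  let ?x = "vector [(s * c2$2 - t * c1$2) / cross2 c1 c2, (t * c1$1 - s * c2$1) / cross2 c1 c2] :: real^2"
  show "c1 \<bullet> ?x = s" "c2 \<bullet> ?x = t"
    using assms by (simp_all add: inner_real2 field_simps) (simp_all add: cross2_def algebra_simps)
qed

lemma cross2_inner_inj:
  assumes "cross2 c1 c2 \<noteq> 0" "c1 \<bullet> x = c1 \<bullet> y" "c2 \<bullet> x = c2 \<bullet> y"
  shows "x = y"
proof -
  have "cross2 c1 c2 * (x$1 - y$1) = c2$2 * (c1 \<bullet> x - c1 \<bullet> y) - c1$2 * (c2 \<bullet> x - c2 \<bullet> y)"
    "cross2 c1 c2 * (x$2 - y$2) = c1$1 * (c2 \<bullet> x - c2 \<bullet> y) - c2$1 * (c1 \<bullet> x - c1 \<bullet> y)"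
    by (simp_all add: cross2_def inner_real2 algebra_simps)
  then show ?thesis using assms by (simp add: vec_eq_real2)
qed

lemma collinear_iff_cross2: "collinear {0, u, v} \<longleftrightarrow> cross2 u v = 0"
proof
  show "cross2 u v = 0" if "collinear {0, u, v}"
    using that by (auto simp: collinear_lemma cross2_def)
  show "collinear {0, u, v}" if *: "cross2 u v = 0"
  proof (cases "u = 0")
    case False
    then have "v = (v$1 / u$1) *\<^sub>R u \<or> v = (v$2 / u$2) *\<^sub>R u"
      using * by (auto simp: vec_eq_real2 cross2_def field_simps)
    then show ?thesis unfolding collinear_lemma by blast
  qed auto
qed

lemma cross2_eq_0E:
  assumes "cross2 u v = 0" "u \<noteq> 0"
  obtains k where "v = k *\<^sub>R u"
proof (cases "v = 0")
  case True
  then show ?thesis using that[of 0] by simp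
next
  case False
  then show ?thesis
    using assms that collinear_iff_cross2[of u v] collinear_lemma[of u v] by blast
qed

lemma cross2_expand:
  assumes "cross2 u v \<noteq> 0"
  shows "x = (cross2 x v / cross2 u v) *\<^sub>R u + (cross2 u x / cross2 u v) *\<^sub>R v"
  using assms by (simp add: vec_eq_real2 field_simps) (simp add: cross2_def algebra_simps)

lemma parallelogram_convex_hull:
  fixes a u v :: "'a::real_vector"
  shows "convex hull {a, a + u, a + u + v, a + v} = {a + s *\<^sub>R u + t *\<^sub>R v | s t. s \<in> {0..1} \<and> t \<in> {0..1}}"
    (is "?H = ?P")
proof
  have "convex ?P"
    unfolding convex_alt
  proof (intro ballI allI impI)
    fix x y and l :: real assume "x \<in> ?P" "y \<in> ?P" and l: "0 \<le> l \<and> l \<le> 1"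
    then obtain s t s' t' where
      *: "x = a + s *\<^sub>R u + t *\<^sub>R v" "s \<in> {0..1}" "t \<in> {0..1}"
        "y = a + s' *\<^sub>R u + t' *\<^sub>R v" "s' \<in> {0..1}" "t' \<in> {0..1}"
      by blast
    have "(1 - l) *\<^sub>R x + l *\<^sub>R y =
        a + ((1 - l) * s + l * s') *\<^sub>R u + ((1 - l) * t + l * t') *\<^sub>R v"
      by (simp add: *(1,4) algebra_simps)
    moreover have "(1 - l) * s + l * s' \<in> {0..1}" "(1 - l) * t + l * t' \<in> {0..1}"
      using l *(2,3,5,6) by (auto intro: convex_bound_le)
    ultimately show "(1 - l) *\<^sub>R x + l *\<^sub>R y \<in> ?P" by blast
  qed
  moreover have "{a, a + u, a + u + v, a + v} \<subseteq> ?P"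
  proof -
    have "a + s *\<^sub>R u + t *\<^sub>R v \<in> ?P" if "s \<in> {0..1}" "t \<in> {0..1}" for s t using that by blast
    from this[of 0 0] this[of 1 0] this[of 1 1] this[of 0 1] show ?thesis by simp
  qed
  ultimately show "?H \<subseteq> ?P" by (intro hull_minimal)
  show "?P \<subseteq> ?H"
  proof
    fix x assume "x \<in> ?P"
    then obtain s t where x: "x = a + s *\<^sub>R u + t *\<^sub>R v" and st: "s \<in> {0..1}" "t \<in> {0..1}" by blast
    have H: "a \<in> ?H" "a + u \<in> ?H" "a + u + v \<in> ?H" "a + v \<in> ?H" by (auto intro: hull_inc)
    \<comment> \<open>Bilinear interpolation: along the two sides parallel to v, then between the
      two points reached.\<close>
    have "(1 - t) *\<^sub>R a + t *\<^sub>R (a + v) \<in> ?H" "(1 - t) *\<^sub>R (a + u) + t *\<^sub>R (a + u + v) \<in> ?H"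
      by (rule convexD[OF convex_convex_hull H(1,4)] convexD[OF convex_convex_hull H(2,3)]; use st in simp)+
    then have "(1 - s) *\<^sub>R ((1 - t) *\<^sub>R a + t *\<^sub>R (a + v)) + s *\<^sub>R ((1 - t) *\<^sub>R (a + u) + t *\<^sub>R (a + u + v)) \<in> ?H"
      by (rule convexD[OF convex_convex_hull]) (use st in simp_all)
    also have "(1 - s) *\<^sub>R ((1 - t) *\<^sub>R a + t *\<^sub>R (a + v)) + s *\<^sub>R ((1 - t) *\<^sub>R (a + u) + t *\<^sub>R (a + u + v)) = x"
      by (simp add: x algebra_simps)
    finally show "x \<in> ?H" .
  qed
qed

section \<open>Norms determined by their unit balls\<close>

lemma is_normD:
  assumes "is_norm N"
  shows "0 \<le> N x" "N x = 0 \<longleftrightarrow> x = 0" "N (a *\<^sub>R x) = \<bar>a\<bar> * N x" "N (x + y) \<le> N x + N y"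
  using assms by (auto simp: is_norm_def)

text \<open>Scaling x by \<open>1 / N x\<close> puts it into the ball of N, hence of M, so M x <= N
  x; the situation is symmetric in N and M.\<close>

lemma is_norm_eqI:
  assumes N: "is_norm N" and M: "is_norm M" and ball: "\<And>x. N x \<le> 1 \<longleftrightarrow> M x \<le> 1"
  shows "N x = M x"
proof -
  have le: "M x \<le> N x" if N: "is_norm N" and M: "is_norm M" and ball: "\<And>x. N x \<le> 1 \<longleftrightarrow> M x \<le> 1" for N M
  proof (cases "x = 0")
    case False
    then have pos: "N x > 0" using is_normD(1,2)[OF N, of x] by linarith
    then have "M ((1 / N x) *\<^sub>R x) \<le> 1"
      unfolding ball[symmetric] is_normD(3)[OF N] by simp
    then show ?thesis
      using pos unfolding is_normD(3)[OF M] by (simp add: field_simps)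
  next
    case True
    then show ?thesis using is_normD(2)[OF N, of x] is_normD(2)[OF M, of x] by simp
  qed
  show ?thesis using le[OF N M ball] le[OF M N ball[symmetric]] by simp
qed

lemma is_norm_max_abs:
  assumes "cross2 c1 c2 \<noteq> 0"
  shows "is_norm (\<lambda>x. max \<bar>c1 \<bullet> x\<bar> \<bar>c2 \<bullet> x\<bar>)"
  unfolding is_norm_def
proof (intro conjI allI)
  show "max \<bar>c1 \<bullet> x\<bar> \<bar>c2 \<bullet> x\<bar> = 0 \<longleftrightarrow> x = 0" for x
    using cross2_inner_inj[OF assms, of x 0] by (auto simp: max_def)
  show "max \<bar>c1 \<bullet> (a *\<^sub>R x)\<bar> \<bar>c2 \<bullet> (a *\<^sub>R x)\<bar> = \<bar>a\<bar> * max \<bar>c1 \<bullet> x\<bar> \<bar>c2 \<bullet> x\<bar>" for a x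
    by (simp add: abs_mult max_mult_distrib_left)
qed (auto simp: inner_add_right)

lemma box_metric_max:
  assumes "box_metric d"
  obtains c1 c2 where "cross2 c1 c2 \<noteq> 0" "\<And>x y. d x y = max \<bar>c1 \<bullet> x - c1 \<bullet> y\<bar> \<bar>c2 \<bullet> x - c2 \<bullet> y\<bar>"
proof -
  obtain N where N: "is_norm N" and d: "\<And>x y. d x y = N (x - y)"
    using assms by (auto simp: box_metric_def norm_derived_def)
  obtain a u v where uv: "cross2 u v \<noteq> 0" and "shape d = convex hull {a, a + u, a + u + v, a + v}"
    using assms by (auto simp: box_metric_def parallelogram_def collinear_iff_cross2)
  then have shape: "N x \<le> 1 \<longleftrightarrow> (\<exists>s t. x = a + s *\<^sub>R u + t *\<^sub>R v \<and> s \<in> {0..1} \<and> t \<in> {0..1})" for x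
    by (auto simp: shape_def d parallelogram_convex_hull set_eq_iff)
  define D where "D = cross2 u v"
  \<comment> \<open>Twice the dual basis of u, v: along each side one coordinate grows by 2, the
    length of the interval from -1 to 1.\<close>
  define c1 where "c1 = (2 / D) *\<^sub>R (vector [v$2, - v$1] :: real^2)"
  define c2 where "c2 = (2 / D) *\<^sub>R (vector [- u$2, u$1] :: real^2)"
  have c1: "c1 \<bullet> x = 2 * cross2 x v / D" and c2: "c2 \<bullet> x = 2 * cross2 u x / D" for x
    by (simp_all add: c1_def c2_def inner_real2 cross2_def algebra_simps diff_divide_distrib)
  have D: "D \<noteq> 0" using uv by (simp add: D_def)
  have cu: "c1 \<bullet> u = 2" "c1 \<bullet> v = 0" "c2 \<bullet> u = 0" "c2 \<bullet> v = 2"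
    using D unfolding c1 c2 by (simp_all add: D_def) (simp_all add: cross2_def)
  have c12: "cross2 c1 c2 \<noteq> 0"
  proof -
    have "cross2 c1 c2 = (2 / D)\<^sup>2 * D"
      unfolding c1_def c2_def cross2_scaleR power2_eq_square by (simp add: cross2_def D_def algebra_simps)
    then show ?thesis using D by simp
  qed
  have ball: "N x \<le> 1 \<longleftrightarrow> c1 \<bullet> (x - a) \<in> {0..2} \<and> c2 \<bullet> (x - a) \<in> {0..2}" for x
  proof
    assume "N x \<le> 1"
    then show "c1 \<bullet> (x - a) \<in> {0..2} \<and> c2 \<bullet> (x - a) \<in> {0..2}"
      by (auto simp: shape inner_add_right cu)
  next
    assume *: "c1 \<bullet> (x - a) \<in> {0..2} \<and> c2 \<bullet> (x - a) \<in> {0..2}"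
    have "x - a = (c1 \<bullet> (x - a) / 2) *\<^sub>R u + (c2 \<bullet> (x - a) / 2) *\<^sub>R v"
      by (rule cross2_inner_inj[OF c12]) (simp_all add: inner_add_right cu)
    then have "x = a + (c1 \<bullet> (x - a) / 2) *\<^sub>R u + (c2 \<bullet> (x - a) / 2) *\<^sub>R v"
      by (simp add: algebra_simps)
    with * show "N x \<le> 1" unfolding shape
      by (intro exI[of _ "c1 \<bullet> (x - a) / 2"] exI[of _ "c2 \<bullet> (x - a) / 2"]) auto
  qed
  have sym: "N (- x) = N x" for x using is_normD(3)[OF N, of "-1" x] by simp
  have ball': "N x \<le> 1 \<longleftrightarrow> c1 \<bullet> x - c1 \<bullet> a \<in> {0..2} \<and> c2 \<bullet> x - c2 \<bullet> a \<in> {0..2}" for x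
    unfolding ball inner_diff_right ..
  \<comment> \<open>Two opposite vertices and, by symmetry of N, their negatives lie in the ball.
    This forces both coordinates of a to be -1, so the parallelogram is centred at 0.\<close>
  have "N a \<le> 1" "N (a + u + v) \<le> 1" unfolding ball' inner_add_right cu by simp_all
  then have "N (- a) \<le> 1" "N (- (a + u + v)) \<le> 1" by (simp_all only: sym)
  then have "c1 \<bullet> a = - 1" "c2 \<bullet> a = - 1"
    unfolding ball' inner_minus_right inner_add_right cu by simp_all
  then have "N x \<le> 1 \<longleftrightarrow> max \<bar>c1 \<bullet> x\<bar> \<bar>c2 \<bullet> x\<bar> \<le> 1" for x
    by (auto simp: ball')
  then have "N x = max \<bar>c1 \<bullet> x\<bar> \<bar>c2 \<bullet> x\<bar>" for x
    by (intro is_norm_eqI[OF N is_norm_max_abs[OF c12]])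
  then show ?thesis using that[OF c12] by (simp add: d inner_diff_right)
qed

section \<open>Box metrics are predictable\<close>

text \<open>Points are chosen recursively, the n-th one in the n-th nonempty basic open set. Each
  choice has to avoid countably many hyperplanes, on which c1 or c2 differs by an integer from its
  value at an earlier point; they are null sets and cannot cover an open set.\<close>

lemma exists_integer_distance_free:
  fixes c1 c2 :: "'a::euclidean_space"
  assumes "c1 \<noteq> 0" "c2 \<noteq> 0"
  obtains V :: "'a set" where "countable V" "closure V = UNIV"
    "\<And>x y. \<lbrakk>x \<in> V; y \<in> V; x \<noteq> y\<rbrakk> \<Longrightarrow> c1 \<bullet> x - c1 \<bullet> y \<notin> \<int> \<and> c2 \<bullet> x - c2 \<bullet> y \<notin> \<int>"
proof -
  obtain \<B> :: "'a set set" where \<B>: "countable \<B>" "topological_basis \<B>"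
    using ex_countable_basis by metis
  define \<B>' where "\<B>' = \<B> - {{}}"
  have ne: "\<B>' \<noteq> {}"
    using topological_basisE[OF \<B>(2) open_UNIV UNIV_I] by (auto simp: \<B>'_def)
  have cnt: "countable \<B>'" using \<B>(1) by (simp add: \<B>'_def)
  define B where "B = from_nat_into \<B>'"
  have B: "open (B n)" "B n \<noteq> {}" for n
    using from_nat_into[OF ne, of n] topological_basis_open[OF \<B>(2)] by (auto simp: B_def \<B>'_def)
  define P where "P f n z \<longleftrightarrow> z \<in> B n \<and> (\<forall>m<n. c1 \<bullet> z - c1 \<bullet> f m \<notin> \<int> \<and> c2 \<bullet> z - c2 \<bullet> f m \<notin> \<int>)"
    for f :: "nat \<Rightarrow> 'a" and n z
  have "\<exists>x. \<forall>n. P x n (x n)"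
  proof (rule dependent_wellorder_choice)
    show "P f n z = P g n z" if "\<And>m. m < n \<Longrightarrow> f m = g m" for z f g n
      using that by (simp add: P_def)
    show "\<exists>z. P f n z" for n f
    proof (rule ccontr)
      let ?L = "\<lambda>(c, m, k). {z. c \<bullet> z = c \<bullet> f m + of_int k}"
      assume *: "\<not> (\<exists>z. P f n z)"
      have "B n \<subseteq> (\<Union>i\<in>{c1, c2} \<times> UNIV \<times> (UNIV::int set). ?L i)"
      proof
        fix z assume "z \<in> B n"
        with * have "\<exists>m. \<exists>c\<in>{c1, c2}. c \<bullet> z - c \<bullet> f m \<in> \<int>" by (auto simp: P_def)
        then obtain m c where "c \<in> {c1, c2}" "c \<bullet> z - c \<bullet> f m \<in> \<int>" by blast
        then obtain k where "c \<bullet> z - c \<bullet> f m = of_int k" by (auto elim: Ints_cases)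
        then have "z \<in> ?L (c, m, k)" by (simp add: algebra_simps)
        then show "z \<in> (\<Union>i\<in>{c1, c2} \<times> UNIV \<times> (UNIV::int set). ?L i)"
          using \<open>c \<in> {c1, c2}\<close> by blast
      qed
      moreover have "negligible (\<Union>i\<in>{c1, c2} \<times> UNIV \<times> (UNIV::int set). ?L i)"
      proof (rule negligible_countable_Union)
        show "negligible S" if "S \<in> ?L ` ({c1, c2} \<times> UNIV \<times> (UNIV::int set))" for S
          using that assms by (auto intro: negligible_hyperplane)
      qed (auto intro!: countable_image countable_SIGMA)
      ultimately have "negligible (B n)" by (rule negligible_subset[rotated])
      then show False using open_not_negligible[OF B] by blast
    qed
  qed
  then obtain x where x: "\<And>n. P x n (x n)" by auto
  show ?thesis
  proof
    show "countable (range x)" by simp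
    show "closure (range x) = UNIV"
    proof (rule ccontr)
      assume "closure (range x) \<noteq> UNIV"
      then obtain z where z: "z \<in> - closure (range x)" by auto
      have "open (- closure (range x))" by auto
      from topological_basisE[OF \<B>(2) this z] obtain W where
        W: "W \<in> \<B>" "z \<in> W" "W \<subseteq> - closure (range x)" by auto
      then have "W \<in> \<B>'" by (auto simp: \<B>'_def)
      then obtain n where "W = B n"
        using from_nat_into_surj[OF cnt] unfolding B_def by metis
      then have "x n \<in> W" using x[of n] by (simp add: P_def)
      moreover have "x n \<in> closure (range x)" by (rule closure_subset[THEN subsetD]) simp
      ultimately show False using W by auto
    qed
    have *: "c1 \<bullet> x n - c1 \<bullet> x m \<notin> \<int> \<and> c2 \<bullet> x n - c2 \<bullet> x m \<notin> \<int>" if "m < n" for m n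
      using x[of n] that by (simp add: P_def)
    fix y z assume "y \<in> range x" "z \<in> range x" "y \<noteq> z"
    then obtain m n where mn: "y = x m" "z = x n" "m \<noteq> n" by auto
    have neg: "c \<bullet> a - c \<bullet> b \<notin> \<int>" if "c \<bullet> b - c \<bullet> a \<notin> \<int>" for a b c
      using that by (metis Ints_minus minus_diff_eq)
    from mn(3) show "c1 \<bullet> y - c1 \<bullet> z \<notin> \<int> \<and> c2 \<bullet> y - c2 \<bullet> z \<notin> \<int>"
      using *[of m n] *[of n m] neg unfolding mn by (metis linorder_neqE_nat)
  qed
qed

text \<open>Compatibility is a condition on pairs, and any two members of the union of an increasing
  chain lie in a common stage. So the union of finite compatible sets is compatible, and
  \<open>inj\<close> makes it the graph of a bijection.\<close>

lemma back_and_forth: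
  fixes Q :: "'a \<times> 'b \<Rightarrow> 'a \<times> 'b \<Rightarrow> bool"
  assumes A: "countable A" "A \<noteq> {}" and B: "countable B" "B \<noteq> {}"
    and inj: "\<And>x y x' y'. Q (x, y) (x', y') \<Longrightarrow> x = x' \<longleftrightarrow> y = y'"
    and fwd: "\<And>g x. \<lbrakk>finite g; g \<subseteq> A \<times> B; \<forall>p\<in>g. \<forall>q\<in>g. Q p q; x \<in> A\<rbrakk> \<Longrightarrow>
      \<exists>y\<in>B. \<forall>p\<in>insert (x, y) g. \<forall>q\<in>insert (x, y) g. Q p q"
    and bwd: "\<And>g y. \<lbrakk>finite g; g \<subseteq> A \<times> B; \<forall>p\<in>g. \<forall>q\<in>g. Q p q; y \<in> B\<rbrakk> \<Longrightarrow>
      \<exists>x\<in>A. \<forall>p\<in>insert (x, y) g. \<forall>q\<in>insert (x, y) g. Q p q"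
  obtains f where "bij_betw f A B" "\<And>x x'. \<lbrakk>x \<in> A; x' \<in> A\<rbrakk> \<Longrightarrow> Q (x, f x) (x', f x')"
proof -
  define ok where "ok g \<longleftrightarrow> finite g \<and> g \<subseteq> A \<times> B \<and> (\<forall>p\<in>g. \<forall>q\<in>g. Q p q)" for g
  have "\<exists>G. \<forall>n. ok (G n) \<and> (G n \<subseteq> G (Suc n) \<and> from_nat_into A n \<in> fst ` G (Suc n) \<and>
      from_nat_into B n \<in> snd ` G (Suc n))"
  proof (rule dependent_nat_choice)
    show "\<exists>g. ok g" by (rule exI[of _ "{}"]) (simp add: ok_def)
    fix g n assume g: "ok g"
    have "from_nat_into A n \<in> A" using A(2) by (rule from_nat_into)
    with g fwd[of g] obtain y where y: "y \<in> B" "ok (insert (from_nat_into A n, y) g)"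
      unfolding ok_def by (metis finite_insert insert_subset mem_Sigma_iff)
    define g1 where "g1 = insert (from_nat_into A n, y) g"
    have "from_nat_into B n \<in> B" using B(2) by (rule from_nat_into)
    with y(2) bwd[of g1] obtain x where x: "x \<in> A" "ok (insert (x, from_nat_into B n) g1)"
      unfolding ok_def g1_def[symmetric] by (metis finite_insert insert_subset mem_Sigma_iff)
    show "\<exists>g'. ok g' \<and> (g \<subseteq> g' \<and> from_nat_into A n \<in> fst ` g' \<and> from_nat_into B n \<in> snd ` g')"
      by (rule exI[of _ "insert (x, from_nat_into B n) g1"]) (use x(2) in \<open>auto simp: g1_def\<close>)
  qed
  then obtain G where G: "\<And>n. ok (G n)" "\<And>n. G n \<subseteq> G (Suc n)"
    "\<And>n. from_nat_into A n \<in> fst ` G (Suc n)" "\<And>n. from_nat_into B n \<in> snd ` G (Suc n)"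
    by auto
  define R where "R = (\<Union>n. G n)"
  have mono: "G m \<subseteq> G n" if "m \<le> n" for m n
    using that G(2) by (rule lift_Suc_mono_le[rotated])
  have Q: "Q p q" if pq: "p \<in> R" "q \<in> R" for p q
  proof -
    obtain m n where "p \<in> G m" "q \<in> G n" using pq unfolding R_def by blast
    then have "p \<in> G (max m n)" "q \<in> G (max m n)" using mono by (meson max.cobounded1 max.cobounded2 subsetD)+
    then show ?thesis using G(1) by (auto simp: ok_def)
  qed
  have R: "R \<subseteq> A \<times> B" using G(1) by (auto simp: R_def ok_def)
  have "\<exists>y. (x, y) \<in> R" if "x \<in> A" for x
    using from_nat_into_surj[OF A(1) that] G(3) by (force simp: R_def)
  then obtain f where f: "\<And>x. x \<in> A \<Longrightarrow> (x, f x) \<in> R" by metis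
  have ex: "\<exists>x. (x, y) \<in> R" if "y \<in> B" for y
    using from_nat_into_surj[OF B(1) that] G(4) by (force simp: R_def)
  have "bij_betw f A B"
    unfolding bij_betw_def
  proof
    show "inj_on f A" using Q[OF f f] inj by (intro inj_onI) blast
    show "f ` A = B"
    proof
      show "f ` A \<subseteq> B" using f R by auto
      show "B \<subseteq> f ` A"
      proof
        fix y assume "y \<in> B"
        then obtain x where x: "(x, y) \<in> R" using ex by auto
        then have "x \<in> A" using R by auto
        with inj[OF Q[OF x f]] show "y \<in> f ` A" by auto
      qed
    qed
  qed
  then show ?thesis using that Q f by blast
qed

text \<open>The conditions on s say that it lies in the open unit interval from
  \<open>b i + m i\<close> to \<open>b i + m i + 1\<close>, where m i is the integer part of
  \<open>t - a i\<close>. Intervals on a line that meet pairwise have a common part, and those for i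
  and j meet because the assumption transfers \<open>a i - a j < m j - m i + 1\<close> to b. The
  bound here can be any integer, hence the quantifier over k.\<close>

lemma interval_extension:
  fixes a b :: "'i \<Rightarrow> real"
  assumes I: "finite I" and ab: "\<And>i j k. \<lbrakk>i \<in> I; j \<in> I\<rbrakk> \<Longrightarrow> a i - a j < of_int k \<longleftrightarrow> b i - b j < of_int k"
    and t: "\<And>i. i \<in> I \<Longrightarrow> t - a i \<notin> \<int>"
  obtains l u where "l < u" "\<And>s i k. \<lbrakk>l < s; s < u; i \<in> I\<rbrakk> \<Longrightarrow>
    s - b i \<notin> \<int> \<and> (t - a i < of_int k \<longleftrightarrow> s - b i < of_int k) \<and> (a i - t < of_int k \<longleftrightarrow> b i - s < of_int k)"
proof (cases "I = {}")
  case True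
  then show ?thesis using that[of 0 1] by simp
next
  case False
  define m where "m i = \<lfloor>t - a i\<rfloor>" for i
  have m: "of_int (m i) < t - a i" "t - a i < of_int (m i) + 1" if "i \<in> I" for i
    using t[OF that] floor_correct[of "t - a i"] unfolding m_def by (auto simp: less_le)
  define l where "l = Max ((\<lambda>i. b i + of_int (m i)) ` I)"
  define u where "u = Min ((\<lambda>i. b i + of_int (m i) + 1) ` I)"
  have l: "b i + of_int (m i) \<le> l" and u: "u \<le> b i + of_int (m i) + 1" if "i \<in> I" for i
    using that I by (auto simp: l_def u_def)
  show ?thesis
  proof
    have "b i + of_int (m i) < b j + of_int (m j) + 1" if "i \<in> I" "j \<in> I" for i j
    proof -
      have "a i - a j < of_int (m j - m i + 1)" using m[of i] m[of j] that by simp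
      then have "b i - b j < of_int (m j - m i + 1)" using ab that by blast
      then show ?thesis by simp
    qed
    then show "l < u" using I False by (auto simp: l_def u_def)
    fix s i k assume s: "l < s" "s < u" and i: "i \<in> I"
    have s': "of_int (m i) < s - b i" "s - b i < of_int (m i) + 1" using l[OF i] u[OF i] s by linarith+
    have "s - b i \<notin> \<int>"
    proof
      assume "s - b i \<in> \<int>"
      then obtain n where "s - b i = of_int n" by (auto elim: Ints_cases)
      with s' have "of_int (m i) < (of_int n :: real)" "(of_int n :: real) < of_int (m i + 1)" by simp_all
      then show False unfolding of_int_less_iff by simp
    qed
    moreover have "t - a i < of_int k \<longleftrightarrow> m i < k" "s - b i < of_int k \<longleftrightarrow> m i < k"
      "a i - t < of_int k \<longleftrightarrow> - k \<le> m i" "b i - s < of_int k \<longleftrightarrow> - k \<le> m i"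
      using m[OF i] s' by linarith+
    ultimately show "s - b i \<notin> \<int> \<and> (t - a i < of_int k \<longleftrightarrow> s - b i < of_int k) \<and>
        (a i - t < of_int k \<longleftrightarrow> b i - s < of_int k)" by simp
  qed
qed

text \<open>Keeping the integer parts of all coordinate differences makes every finite partial isomorphism
  extendable.\<close>

definition box_rel where
  "box_rel c1 c2 E1 E2 p q \<longleftrightarrow> (fst p = fst q \<longleftrightarrow> snd p = snd q) \<and>
     (\<forall>k::int. c1 \<bullet> fst p - c1 \<bullet> fst q < of_int k \<longleftrightarrow> c1 \<bullet> snd p - c1 \<bullet> snd q < of_int k) \<and>
     (\<forall>k::int. c2 \<bullet> fst p - c2 \<bullet> fst q < of_int k \<longleftrightarrow> c2 \<bullet> snd p - c2 \<bullet> snd q < of_int k) \<and>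
     ({fst p, fst q} \<in> E1 \<longleftrightarrow> {snd p, snd q} \<in> E2)"

text \<open>Extending the two coordinates separately gives a nonempty open box W, every point of
  which has the right integer parts relative to the old points. On W "distance < 1" to an old image
  agrees with the situation of x, so existential closedness can be used to get the right adjacencies
  as well.\<close>

lemma box_rel_extend:
  fixes c1 c2 :: "real^2"
  assumes d: "\<And>x y. d x y = max \<bar>c1 \<bullet> x - c1 \<bullet> y\<bar> \<bar>c2 \<bullet> x - c2 \<bullet> y\<bar>" and c: "cross2 c1 c2 \<noteq> 0"
    and gec: "gec d V E2" and E: "E1 \<subseteq> close_pairs d V" "E2 \<subseteq> close_pairs d V"
    and idf: "\<And>x y. \<lbrakk>x \<in> V; y \<in> V; x \<noteq> y\<rbrakk> \<Longrightarrow> c1 \<bullet> x - c1 \<bullet> y \<notin> \<int> \<and> c2 \<bullet> x - c2 \<bullet> y \<notin> \<int>"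
    and g: "finite g" "g \<subseteq> V \<times> V" "\<forall>p\<in>g. \<forall>q\<in>g. box_rel c1 c2 E1 E2 p q"
    and x: "x \<in> V"
  shows "\<exists>y\<in>V. \<forall>p\<in>insert (x, y) g. \<forall>q\<in>insert (x, y) g. box_rel c1 c2 E1 E2 p q"
proof (cases "x \<in> fst ` g")
  case True
  then obtain y where "(x, y) \<in> g" by force
  then show ?thesis using g by (intro bexI[of _ y]) (auto simp: insert_absorb)
next
  case False
  have nint: "c1 \<bullet> x - c1 \<bullet> fst p \<notin> \<int>" "c2 \<bullet> x - c2 \<bullet> fst p \<notin> \<int>" if "p \<in> g" for p
  proof -
    have "fst p \<in> V" "x \<noteq> fst p" using that g(2) False by auto
    then show "c1 \<bullet> x - c1 \<bullet> fst p \<notin> \<int>" "c2 \<bullet> x - c2 \<bullet> fst p \<notin> \<int>" using idf x by auto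
  qed
  obtain l1 u1 where lu1: "l1 < u1" "\<And>s p k. \<lbrakk>l1 < s; s < u1; p \<in> g\<rbrakk> \<Longrightarrow>
      s - c1 \<bullet> snd p \<notin> \<int> \<and> (c1 \<bullet> x - c1 \<bullet> fst p < of_int k \<longleftrightarrow> s - c1 \<bullet> snd p < of_int k) \<and>
      (c1 \<bullet> fst p - c1 \<bullet> x < of_int k \<longleftrightarrow> c1 \<bullet> snd p - s < of_int k)"
    by (rule interval_extension[of g "\<lambda>p. c1 \<bullet> fst p" "\<lambda>p. c1 \<bullet> snd p" "c1 \<bullet> x"])
      (use g nint in \<open>auto simp: box_rel_def\<close>)
  obtain l2 u2 where lu2: "l2 < u2" "\<And>s p k. \<lbrakk>l2 < s; s < u2; p \<in> g\<rbrakk> \<Longrightarrow>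
      s - c2 \<bullet> snd p \<notin> \<int> \<and> (c2 \<bullet> x - c2 \<bullet> fst p < of_int k \<longleftrightarrow> s - c2 \<bullet> snd p < of_int k) \<and>
      (c2 \<bullet> fst p - c2 \<bullet> x < of_int k \<longleftrightarrow> c2 \<bullet> snd p - s < of_int k)"
    by (rule interval_extension[of g "\<lambda>p. c2 \<bullet> fst p" "\<lambda>p. c2 \<bullet> snd p" "c2 \<bullet> x"])
      (use g nint in \<open>auto simp: box_rel_def\<close>)
  define W where "W = {z. l1 < c1 \<bullet> z} \<inter> {z. c1 \<bullet> z < u1} \<inter> {z. l2 < c2 \<bullet> z} \<inter> {z. c2 \<bullet> z < u2}"
  have "open W" unfolding W_def
    by (intro open_Int open_halfspace_lt) (auto intro: open_halfspace_gt)
  moreover have "W \<noteq> {}"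
  proof -
    obtain z where "c1 \<bullet> z = (l1 + u1) / 2" "c2 \<bullet> z = (l2 + u2) / 2"
      using cross2_nonzeroE[OF c] by metis
    then have "z \<in> W" using lu1(1) lu2(1) by (auto simp: W_def)
    then show ?thesis by auto
  qed
  have W1: "(c1 \<bullet> x - c1 \<bullet> fst p < of_int k \<longleftrightarrow> c1 \<bullet> z - c1 \<bullet> snd p < of_int k) \<and>
      (c1 \<bullet> fst p - c1 \<bullet> x < of_int k \<longleftrightarrow> c1 \<bullet> snd p - c1 \<bullet> z < of_int k)"
    and W2: "(c2 \<bullet> x - c2 \<bullet> fst p < of_int k \<longleftrightarrow> c2 \<bullet> z - c2 \<bullet> snd p < of_int k) \<and>
      (c2 \<bullet> fst p - c2 \<bullet> x < of_int k \<longleftrightarrow> c2 \<bullet> snd p - c2 \<bullet> z < of_int k)"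
    and W3: "z \<noteq> snd p" if "z \<in> W" "p \<in> g" for z p k
    using that lu1(2)[of "c1 \<bullet> z" p] lu2(2)[of "c2 \<bullet> z" p] by (auto simp: W_def)
  have dist: "d x (fst p) < 1 \<longleftrightarrow> d z (snd p) < 1" if "z \<in> W" "p \<in> g" for z p
    using W1[OF that, of 1] W2[OF that, of 1] unfolding d by (simp add: abs_less_iff)
  define A where "A = snd ` {p \<in> g. {x, fst p} \<in> E1}"
  \<comment> \<open>Only nonneighbours at distance < 1 enter B. The remaining old points are never
    adjacent to a point of W, and existential closedness applies only to points at distance < 1 from
    all of W.\<close>
  define B where "B = snd ` {p \<in> g. d x (fst p) < 1 \<and> {x, fst p} \<notin> E1}"
  have E1_dist: "d x y < 1" if "{x, y} \<in> E1" for y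
  proof -
    have "{x, y} \<in> close_pairs d V" using that E by auto
    then show ?thesis by (auto simp: close_pairs_def d doubleton_eq_iff abs_minus_commute)
  qed
  have E2_dist: "d x y < 1" if "{x, y} \<in> E2" for x y
  proof -
    have "{x, y} \<in> close_pairs d V" using that E by auto
    then show ?thesis by (auto simp: close_pairs_def d doubleton_eq_iff abs_minus_commute)
  qed
  have "\<exists>z\<in>W \<inter> V. z \<notin> A \<union> B \<and> (\<forall>a\<in>A. {z, a} \<in> E2) \<and> (\<forall>b\<in>B. {z, b} \<notin> E2)"
  proof (rule gec[unfolded gec_def, rule_format])
    show "finite A" "finite B" "A \<subseteq> V" "B \<subseteq> V" using g by (auto simp: A_def B_def)
    show "A \<inter> B = {}"
    proof (rule equals0I)
      fix a assume "a \<in> A \<inter> B"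
      then obtain p q where "p \<in> g" "q \<in> g" "snd p = snd q" "{x, fst p} \<in> E1" "{x, fst q} \<notin> E1"
        by (auto simp: A_def B_def)
      then show False using g(3) unfolding box_rel_def by metis
    qed
    show "d z a < 1" if "z \<in> W" "a \<in> A \<union> B" for z a
      using that dist[OF that(1)] E1_dist by (auto simp: A_def B_def)
  qed fact+
  then obtain z where z: "z \<in> W" "z \<in> V" "\<And>a. a \<in> A \<Longrightarrow> {z, a} \<in> E2" "\<And>b. b \<in> B \<Longrightarrow> {z, b} \<notin> E2"
    by auto
  have adj: "{x, fst p} \<in> E1 \<longleftrightarrow> {z, snd p} \<in> E2" if "p \<in> g" for p
  proof (cases "d x (fst p) < 1")
    case True
    then show ?thesis using z(3,4)[of "snd p"] that unfolding A_def B_def by blast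
  next
    case False
    then show ?thesis using dist[OF z(1) that] E1_dist E2_dist by auto
  qed
  have loops: "{v, v} \<notin> E1" "{v, v} \<notin> E2" for v
    using E by (auto simp: close_pairs_def)
  have neq: "x \<noteq> fst p" "z \<noteq> snd p" if "p \<in> g" for p
    using that False W3[OF z(1) that] by auto
  have new: "box_rel c1 c2 E1 E2 (x, z) p" "box_rel c1 c2 E1 E2 p (x, z)" if "p \<in> g" for p
    using W1[OF z(1) that] W2[OF z(1) that] adj[OF that] neq[OF that]
    by (auto simp: box_rel_def insert_commute)
  have "box_rel c1 c2 E1 E2 (x, z) (x, z)" using loops[of x] loops[of z] by (simp add: box_rel_def)
  with new g(3) z(2) show ?thesis by (intro bexI[of _ z]) auto
qed

lemma box_graphs_isomorphic:
  fixes c1 c2 :: "real^2"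
  assumes d: "\<And>x y. d x y = max \<bar>c1 \<bullet> x - c1 \<bullet> y\<bar> \<bar>c2 \<bullet> x - c2 \<bullet> y\<bar>" and c: "cross2 c1 c2 \<noteq> 0"
    and V: "countable V" "V \<noteq> {}"
    and idf: "\<And>x y. \<lbrakk>x \<in> V; y \<in> V; x \<noteq> y\<rbrakk> \<Longrightarrow> c1 \<bullet> x - c1 \<bullet> y \<notin> \<int> \<and> c2 \<bullet> x - c2 \<bullet> y \<notin> \<int>"
    and E: "E1 \<subseteq> close_pairs d V" "E2 \<subseteq> close_pairs d V"
    and gec: "gec d V E1" "gec d V E2"
  shows "graph_isomorphic (V, E1) (V, E2)"
proof -
  \<comment> \<open>The relation is symmetric under exchanging the two graphs, so the backward
    extension is the forward one for swapped pairs.\<close>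
  have conv: "box_rel c1 c2 E2 E1 (prod.swap p) (prod.swap q) \<longleftrightarrow> box_rel c1 c2 E1 E2 p q" for p q
    by (auto simp: box_rel_def)
  obtain f where f: "bij_betw f V V" "\<And>x x'. \<lbrakk>x \<in> V; x' \<in> V\<rbrakk> \<Longrightarrow> box_rel c1 c2 E1 E2 (x, f x) (x', f x')"
  proof (rule back_and_forth[OF V V])
    show "x = x' \<longleftrightarrow> y = y'" if "box_rel c1 c2 E1 E2 (x, y) (x', y')" for x y x' y'
      using that by (simp add: box_rel_def)
    show "\<exists>y\<in>V. \<forall>p\<in>insert (x, y) g. \<forall>q\<in>insert (x, y) g. box_rel c1 c2 E1 E2 p q"
      if "finite g" "g \<subseteq> V \<times> V" "\<forall>p\<in>g. \<forall>q\<in>g. box_rel c1 c2 E1 E2 p q" "x \<in> V" for g x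
      by (rule box_rel_extend[OF d c gec(2) E idf that])
    show "\<exists>x\<in>V. \<forall>p\<in>insert (x, y) g. \<forall>q\<in>insert (x, y) g. box_rel c1 c2 E1 E2 p q"
      if g: "finite g" "g \<subseteq> V \<times> V" "\<forall>p\<in>g. \<forall>q\<in>g. box_rel c1 c2 E1 E2 p q" "y \<in> V" for g y
    proof -
      have "\<exists>x\<in>V. \<forall>p\<in>insert (y, x) (prod.swap ` g). \<forall>q\<in>insert (y, x) (prod.swap ` g). box_rel c1 c2 E2 E1 p q"
        by (rule box_rel_extend[OF d c gec(1) E(2,1) idf]) (use g in \<open>auto simp: conv\<close>)
      then obtain x where x: "x \<in> V"
        "\<forall>p\<in>insert (y, x) (prod.swap ` g). \<forall>q\<in>insert (y, x) (prod.swap ` g). box_rel c1 c2 E2 E1 p q"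
        by blast
      have "box_rel c1 c2 E1 E2 p q" if "p \<in> insert (x, y) g" "q \<in> insert (x, y) g" for p q
      proof -
        have "prod.swap p \<in> insert (y, x) (prod.swap ` g)" "prod.swap q \<in> insert (y, x) (prod.swap ` g)"
          using that by auto
        then show ?thesis using x(2) conv by blast
      qed
      then show ?thesis using x(1) by blast
    qed
  qed blast
  have "{u, v} \<in> E1 \<longleftrightarrow> {f u, f v} \<in> E2" if "u \<in> V" "v \<in> V" for u v
    using f(2)[OF that] by (simp add: box_rel_def)
  with f(1) show ?thesis by (auto simp: graph_isomorphic_def)
qed

text \<open>V is obtained from c1 and c2 alone, before p is fixed: predictability demands one vertex
  set for all p.\<close>

lemma box_metric_predictable:
  assumes "box_metric d"
  shows "predictable d"
proof -
  obtain c1 c2 where c: "cross2 c1 c2 \<noteq> 0" and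
    d: "\<And>x y. d x y = max \<bar>c1 \<bullet> x - c1 \<bullet> y\<bar> \<bar>c2 \<bullet> x - c2 \<bullet> y\<bar>"
    using box_metric_max[OF assms] by metis
  have "c1 \<noteq> 0" "c2 \<noteq> 0" using c by (auto simp: cross2_def)
  then obtain V where V: "countable V" "closure V = UNIV" and
    idf: "\<And>x y. \<lbrakk>x \<in> V; y \<in> V; x \<noteq> y\<rbrakk> \<Longrightarrow> c1 \<bullet> x - c1 \<bullet> y \<notin> \<int> \<and> c2 \<bullet> x - c2 \<bullet> y \<notin> \<int>"
    using exists_integer_distance_free[of c1 c2] by metis
  have "V \<noteq> {}" using V(2) by auto
  have "AE (\<omega>1, \<omega>2) in larg d V p \<Otimes>\<^sub>M larg d V p.
          graph_isomorphic (larg_graph d V \<omega>1) (larg_graph d V \<omega>2)" if p: "p \<in> {0<..<1}" for p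
  proof -
    let ?M = "larg d V p"
    interpret prob_space ?M by (rule prob_space_larg)
    interpret P: pair_prob_space ?M ?M ..
    let ?G = "\<lambda>\<omega>. gec d V (snd (larg_graph d V \<omega>))"
    have ae: "AE \<omega> in ?M. ?G \<omega>"
      using p V by (intro AE_larg_gec) auto
    have "AE \<omega> in distr (?M \<Otimes>\<^sub>M ?M) ?M fst. ?G \<omega>"
      unfolding distr_pair_fst by (rule ae)
    from AE_distrD[OF _ this] have 1: "AE \<omega> in ?M \<Otimes>\<^sub>M ?M. ?G (fst \<omega>)" by simp
    have "distr (?M \<Otimes>\<^sub>M ?M) ?M snd = ?M"
    proof -
      have "?M \<Otimes>\<^sub>M ?M = distr (?M \<Otimes>\<^sub>M ?M) (?M \<Otimes>\<^sub>M ?M) (\<lambda>(x, y). (y, x))"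
        by (rule P.distr_pair_swap)
      then have "distr (?M \<Otimes>\<^sub>M ?M) ?M snd =
          distr (distr (?M \<Otimes>\<^sub>M ?M) (?M \<Otimes>\<^sub>M ?M) (\<lambda>(x, y). (y, x))) ?M snd"
        by simp
      also have "\<dots> = distr (?M \<Otimes>\<^sub>M ?M) ?M fst"
        by (subst distr_distr) (auto intro!: distr_cong)
      finally show ?thesis by (simp add: distr_pair_fst)
    qed
    then have "AE \<omega> in distr (?M \<Otimes>\<^sub>M ?M) ?M snd. ?G \<omega>" by (simp only: ae)
    from AE_distrD[OF _ this] have 2: "AE \<omega> in ?M \<Otimes>\<^sub>M ?M. ?G (snd \<omega>)" by simp
    from 1 2 show ?thesis
    proof eventually_elim
      case (elim \<omega>)
      show ?case
        using box_graphs_isomorphic[OF d c V(1) \<open>V \<noteq> {}\<close> idf, of "snd (larg_graph d V (fst \<omega>))"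
            "snd (larg_graph d V (snd \<omega>))"] elim
        by (auto simp: larg_graph_def split: prod.splits)
    qed
  qed
  with V show ?thesis unfolding predictable_def by blast
qed

section \<open>Gradients of a norm\<close>

locale plane_norm =
  fixes N :: "real^2 \<Rightarrow> real"
  assumes is_norm: "is_norm N"
begin

lemma nonneg [simp]: "0 \<le> N x"
  and eq_0_iff [simp]: "N x = 0 \<longleftrightarrow> x = 0"
  and scale: "N (a *\<^sub>R x) = \<bar>a\<bar> * N x"
  and triangle: "N (x + y) \<le> N x + N y"
  using is_norm by (auto simp: is_norm_def)

lemma zero [simp]: "N 0 = 0" by simp

lemma pos_iff [simp]: "0 < N x \<longleftrightarrow> x \<noteq> 0"
  using nonneg[of x] eq_0_iff[of x] by linarith

lemma minus [simp]: "N (- x) = N x"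
  using scale[of "-1" x] by simp

lemma minus_commute: "N (x - y) = N (y - x)"
  using minus[of "x - y"] by simp

lemma triangle_diff: "N (x - z) \<le> N (x - y) + N (y - z)"
  using triangle[of "x - y" "y - z"] by simp

lemma abs_diff_le: "\<bar>N x - N y\<bar> \<le> N (x - y)"
  using triangle_diff[of x 0 y] triangle_diff[of y 0 x] by (simp add: minus_commute[of y x])

lemma le_norm: obtains C where "C > 0" "\<And>x. N x \<le> C * norm x"
proof
  let ?C = "N (axis 1 1) + N (axis 2 1)"
  show "?C > 0" by (intro add_pos_pos) (auto simp: axis_eq_0_iff)
  fix x :: "real^2"
  have "x = (x$1) *\<^sub>R axis 1 1 + (x$2) *\<^sub>R axis 2 1"
    by (simp add: vec_eq_real2 axis_def)
  then have "N x \<le> \<bar>x$1\<bar> * N (axis 1 1) + \<bar>x$2\<bar> * N (axis 2 1)"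
    by (metis triangle scale)
  also have "\<dots> \<le> norm x * N (axis 1 1) + norm x * N (axis 2 1)"
    by (intro add_mono mult_right_mono component_le_norm_cart) auto
  finally show "N x \<le> ?C * norm x" by (simp add: algebra_simps)
qed

lemma continuous_on_N: "continuous_on S N"
proof -
  obtain C where C: "C > 0" "\<And>x. N x \<le> C * norm x" using le_norm by metis
  have "C-lipschitz_on S N"
  proof (rule lipschitz_onI)
    show "dist (N x) (N y) \<le> C * dist x y" for x y
      using abs_diff_le[of x y] C(2)[of "x - y"] by (simp add: dist_norm)
  qed (use C in auto)
  then show ?thesis by (rule lipschitz_on_continuous_on)
qed

lemma continuous_on_N' [continuous_intros]:
  "continuous_on S g \<Longrightarrow> continuous_on S (\<lambda>x. N (g x))"
  using continuous_on_compose2[OF continuous_on_N[of UNIV]] by auto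

lemma tendsto_N [tendsto_intros]: "(g \<longlongrightarrow> l) F \<Longrightarrow> ((\<lambda>x. N (g x)) \<longlongrightarrow> N l) F"
  by (rule continuous_on_tendsto_compose[OF continuous_on_N[of UNIV]]) auto

lemma norm_le: obtains K where "K > 0" "\<And>x. norm x \<le> K * N x"
proof -
  obtain z :: "real^2" where z: "norm z = 1" "\<And>y. norm y = 1 \<Longrightarrow> N z \<le> N y"
  proof -
    have "sphere (0::real^2) 1 \<noteq> {}" by simp
    with continuous_attains_inf[OF compact_sphere _ continuous_on_N] that show thesis
      by (metis mem_sphere_0)
  qed
  have pos: "N z > 0" using z(1) by auto
  show ?thesis
  proof
    show "1 / N z > 0" using pos by simp
    fix x show "norm x \<le> 1 / N z * N x"
    proof (cases "x = 0")
      case False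
      then have "N z \<le> N ((1 / norm x) *\<^sub>R x)" by (intro z(2)) simp
      then show ?thesis using False pos by (simp add: scale field_simps)
    qed simp
  qed
qed

lemma compact_ball: "compact {z. N z \<le> r}"
proof -
  obtain K where K: "K > 0" "\<And>x. norm x \<le> K * N x" using norm_le by metis
  have "bounded {z. N z \<le> r}"
    unfolding bounded_iff
    by (intro exI[of _ "K * r"]) (use K in \<open>auto intro: order_trans[OF K(2)] mult_left_mono\<close>)
  moreover have "closed {z. N z \<le> r}"
    by (intro closed_Collect_le continuous_intros)
  ultimately show ?thesis by (simp add: compact_eq_bounded_closed)
qed

lemma open_ball: "open {z. N (z - a) < r}"
  by (intro open_Collect_less continuous_intros)

lemma tendstoI_N:
  assumes "((\<lambda>i. N (g i - l)) \<longlongrightarrow> 0) F"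
  shows "(g \<longlongrightarrow> l) F"
proof -
  obtain K where K: "K > 0" "\<And>x. norm x \<le> K * N x" using norm_le by metis
  have "((\<lambda>i. K * N (g i - l)) \<longlongrightarrow> 0) F" using tendsto_mult_right_zero[OF assms] by simp
  then have "((\<lambda>i. g i - l) \<longlongrightarrow> 0) F"
    by (rule Lim_null_comparison[rotated]) (use K in auto)
  then show ?thesis by (simp add: LIM_zero_iff)
qed

text \<open>A Gateaux derivative: one-variable derivatives along all lines through v, assembled into
  a linear functional.\<close>

definition has_grad :: "real^2 \<Rightarrow> real^2 \<Rightarrow> bool" where
  "has_grad v c \<longleftrightarrow> (\<forall>w. ((\<lambda>t. N (v + t *\<^sub>R w)) has_real_derivative c \<bullet> w) (at 0))"

lemma has_gradD: "has_grad v c \<Longrightarrow> ((\<lambda>t. (N (v + t *\<^sub>R w) - N v) / t) \<longlongrightarrow> c \<bullet> w) (at 0)"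
  unfolding has_grad_def has_field_derivative_iff by (auto dest!: spec[of _ w])

text \<open>Euler's identity for a function that is homogeneous of degree 1.\<close>

lemma has_grad_inner_self:
  assumes "has_grad v c" shows "c \<bullet> v = N v"
proof (rule tendsto_unique[OF _ has_gradD[OF assms]])
  have "\<forall>\<^sub>F t in at (0::real). t \<in> {-1<..<1} - {0}" by (rule eventually_at_in_open) auto
  then have "\<forall>\<^sub>F t in at (0::real). N v = (N (v + t *\<^sub>R v) - N v) / t"
  proof eventually_elim
    case (elim t)
    have "v + t *\<^sub>R v = (1 + t) *\<^sub>R v" by (simp add: algebra_simps)
    then have "N (v + t *\<^sub>R v) = (1 + t) * N v" using elim by (simp add: scale)
    then show ?case using elim by (simp add: field_simps)
  qed
  then show "((\<lambda>t. (N (v + t *\<^sub>R v) - N v) / t) \<longlongrightarrow> N v) (at 0)"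
    by (rule Lim_transform_eventually[OF tendsto_const])
qed simp

text \<open>The triangle inequality bounds the difference quotients. Together with Euler's identity
  this makes c a supporting functional of the unit ball, of dual norm 1 if v is nonzero.\<close>

lemma has_grad_inner_le:
  assumes "has_grad v c" shows "c \<bullet> w \<le> N w"
proof (rule tendsto_upperbound)
  show "((\<lambda>t. (N (v + t *\<^sub>R w) - N v) / t) \<longlongrightarrow> c \<bullet> w) (at_right 0)"
    by (rule tendsto_mono[OF at_le has_gradD[OF assms]]) auto
  show "\<forall>\<^sub>F t in at_right 0. (N (v + t *\<^sub>R w) - N v) / t \<le> N w"
    using eventually_at_right_less[of 0]
  proof eventually_elim
    case (elim t)
    have "N (v + t *\<^sub>R w) \<le> N v + t * N w" using triangle[of v "t *\<^sub>R w"] elim by (simp add: scale)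
    then show ?case using elim by (simp add: field_simps)
  qed
qed simp

lemma has_grad_abs_inner_le: "has_grad v c \<Longrightarrow> \<bar>c \<bullet> w\<bar> \<le> N w"
  using has_grad_inner_le[of v c w] has_grad_inner_le[of v c "- w"] by (simp add: abs_le_iff)

lemma has_grad_scale:
  assumes "has_grad v c" "r > 0" shows "has_grad (r *\<^sub>R v) c"
  unfolding has_grad_def
proof
  fix w
  have "((\<lambda>t. N (v + t *\<^sub>R w)) has_real_derivative c \<bullet> w) (at (0 / r))"
    using assms by (simp add: has_grad_def)
  then have "((\<lambda>t. r * N (v + (t / r) *\<^sub>R w)) has_real_derivative r * (c \<bullet> w * (1 / r))) (at 0)"
    by (intro DERIV_cmult DERIV_chain2[of "\<lambda>t. N (v + t *\<^sub>R w)"] DERIV_cdivide DERIV_ident)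
  moreover have "r * N (v + (t / r) *\<^sub>R w) = N (r *\<^sub>R v + t *\<^sub>R w)" for t
  proof -
    have "r *\<^sub>R v + t *\<^sub>R w = r *\<^sub>R (v + (t / r) *\<^sub>R w)" using assms(2) by (simp add: algebra_simps)
    then show ?thesis using assms(2) by (simp add: scale)
  qed
  ultimately show "((\<lambda>t. N (r *\<^sub>R v + t *\<^sub>R w)) has_real_derivative c \<bullet> w) (at 0)"
    using assms(2) by simp
qed

lemma has_grad_minus:
  assumes "has_grad v c" shows "has_grad (- v) (- c)"
  unfolding has_grad_def
proof
  fix w
  have "((\<lambda>t. N (v + t *\<^sub>R (- w))) has_real_derivative c \<bullet> (- w)) (at 0)"
    using assms unfolding has_grad_def by blast
  moreover have "N (v + t *\<^sub>R (- w)) = N (- v + t *\<^sub>R w)" for t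
    using minus[of "v - t *\<^sub>R w"] by simp
  ultimately show "((\<lambda>t. N (- v + t *\<^sub>R w)) has_real_derivative (- c) \<bullet> w) (at 0)" by simp
qed

text \<open>By homogeneity, N (x, y) = y h (x / y) for y > 0, where h is the restriction of N to the
  line y = 1. So differentiability of h in one variable suffices; the second component of the
  gradient is dictated by Euler's identity.\<close>

lemma has_grad_line:
  assumes "((\<lambda>s. N (vector [s, 1])) has_real_derivative m) (at t)"
  shows "has_grad (vector [t, 1]) (vector [m, N (vector [t, 1]) - t * m])"
  unfolding has_grad_def
proof
  fix w :: "real^2"
  let ?h = "\<lambda>s. N (vector [s, 1])"
  let ?q = "\<lambda>r. (t + r * w$1) / (1 + r * w$2)"
  have q: "(?q has_real_derivative w$1 - t * w$2) (at 0)"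
    by (auto intro!: derivative_eq_intros simp: algebra_simps)
  have "((\<lambda>r. ?h (?q r)) has_real_derivative m * (w$1 - t * w$2)) (at 0)"
    by (rule DERIV_chain2[OF _ q]) (use assms in simp)
  then have D: "((\<lambda>r. (1 + r * w$2) * ?h (?q r)) has_real_derivative
      w$2 * ?h t + m * (w$1 - t * w$2)) (at 0)"
    by (auto intro!: derivative_eq_intros)
  have ev: "\<forall>\<^sub>F r in nhds 0. (1 + r * w$2) * ?h (?q r) = N (vector [t, 1] + r *\<^sub>R w)"
  proof -
    have "((\<lambda>r. 1 + r * w$2) \<longlongrightarrow> 1 + 0 * w$2) (nhds 0)"
      by (intro tendsto_intros filterlim_ident)
    then have "\<forall>\<^sub>F r in nhds 0. 1 + r * w$2 > 0"
      by (rule order_tendstoD) simp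
    then show ?thesis
    proof eventually_elim
      case (elim r)
      have "vector [t, 1] + r *\<^sub>R w = (1 + r * w$2) *\<^sub>R vector [?q r, 1]"
        using elim by (simp add: vec_eq_real2)
      then show ?case using elim by (simp add: scale)
    qed
  qed
  have "w$2 * ?h t + m * (w$1 - t * w$2) = vector [m, N (vector [t, 1]) - t * m] \<bullet> w"
    by (simp add: inner_real2 algebra_simps)
  from DERIV_cong_ev[OF refl ev this] D
  show "((\<lambda>r. N (vector [t, 1] + r *\<^sub>R w)) has_real_derivative
      vector [m, N (vector [t, 1]) - t * m] \<bullet> w) (at 0)"
    by (rule iffD1)
qed

end

text \<open>Slopes of chords increase, so the one-sided derivatives L t <= R t exist. For t < t' the
  chord between them gives R t <= L t', so the intervals from L t to R t at points of
  nondifferentiability are nonempty and disjoint; each contains a rational number.\<close>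

lemma countable_not_differentiable_convex:
  fixes h :: "real \<Rightarrow> real"
  assumes h: "convex_on UNIV h"
  shows "countable {t. \<nexists>m. (h has_real_derivative m) (at t)}"
proof -
  define s where "s t x = (h x - h t) / (x - t)" for t x
  have sym: "s t x = s x t" for t x
    unfolding s_def using minus_divide_divide[of "h x - h t" "x - t"] by simp
  have mono3: "s a b \<le> s a c" "s a c \<le> s b c" if "a < b" "b < c" for a b c
  proof -
    have "s b a \<le> s c a" "s c a \<le> s c b"
      using convex_on_slope_le[OF h UNIV_I UNIV_I that] by (simp_all add: s_def)
    then show "s a b \<le> s a c" "s a c \<le> s b c" by (simp_all add: sym)
  qed
  define R where "R t = (INF x\<in>{t<..}. s t x)" for t
  define L where "L t = (SUP x\<in>{..<t}. s t x)" for t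
  have cross: "s t x \<le> s t y" if "x < t" "t < y" for x t y
    using mono3[OF that] sym[of t x] by simp
  have bdd: "bdd_below (s t ` {t<..})" "bdd_above (s t ` {..<t})" for t
  proof -
    show "bdd_below (s t ` {t<..})" by (rule bdd_belowI2[of _ "s t (t - 1)"]) (auto intro: cross)
    show "bdd_above (s t ` {..<t})" by (rule bdd_aboveI2[of _ _ "s t (t + 1)"]) (auto intro: cross)
  qed
  have R_le: "R t \<le> s t x" if "t < x" for t x
    unfolding R_def using that by (intro cINF_lower bdd) auto
  have L_ge: "s t x \<le> L t" if "x < t" for t x
    unfolding L_def using that by (intro cSUP_upper bdd) auto
  have LR: "L t \<le> R t" for t
    unfolding L_def
  proof (rule cSUP_least)
    show "s t x \<le> R t" if "x \<in> {..<t}" for x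
      unfolding R_def using that by (intro cINF_greatest) (auto intro: cross)
  qed auto
  have right: "(s t \<longlongrightarrow> R t) (at_right t)" for t
  proof (rule order_tendstoI)
    fix a assume a: "a < R t"
    show "\<forall>\<^sub>F x in at_right t. a < s t x"
      by (rule eventually_mono[OF eventually_at_right_less[of t]]) (rule less_le_trans[OF a R_le])
  next
    fix a assume "R t < a"
    then obtain y where y: "t < y" "s t y < a"
      unfolding R_def using cINF_less_iff[OF _ bdd(1), of t a] by auto
    have "\<forall>\<^sub>F x in at_right t. x \<in> {t<..<y}" using y(1) by (rule eventually_at_right_real)
    then show "\<forall>\<^sub>F x in at_right t. s t x < a"
    proof (rule eventually_mono)
      show "s t x < a" if "x \<in> {t<..<y}" for x using mono3(1)[of t x y] y(2) that by simp
    qed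
  qed
  have left: "(s t \<longlongrightarrow> L t) (at_left t)" for t
  proof (rule order_tendstoI)
    fix a assume a: "L t < a"
    have "\<forall>\<^sub>F x in at_left t. x \<in> {t - 1<..<t}" by (rule eventually_at_left_real) simp
    then show "\<forall>\<^sub>F x in at_left t. s t x < a"
    proof (rule eventually_mono)
      show "s t x < a" if "x \<in> {t - 1<..<t}" for x using L_ge[of x t] a that by simp
    qed
  next
    fix a assume "a < L t"
    then obtain y where y: "y < t" "a < s t y"
      unfolding L_def using less_cSUP_iff[OF _ bdd(2), of t a] by auto
    have "\<forall>\<^sub>F x in at_left t. x \<in> {y<..<t}" using y(1) by (rule eventually_at_left_real)
    then show "\<forall>\<^sub>F x in at_left t. a < s t x"
    proof (rule eventually_mono)
      show "a < s t x" if "x \<in> {y<..<t}" for x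
        using mono3(2)[of y x t] y(2) that sym[of t y] sym[of t x] by simp
    qed
  qed
  have strict: "L t < R t" if "\<nexists>m. (h has_real_derivative m) (at t)" for t
  proof (rule ccontr)
    assume "\<not> L t < R t"
    then have "L t = R t" using LR[of t] by simp
    then have "(s t \<longlongrightarrow> R t) (at t)"
      using left[of t] right[of t] by (simp add: filterlim_at_split)
    then have "(h has_real_derivative R t) (at t)"
      unfolding has_field_derivative_iff s_def .
    with that show False by blast
  qed
  let ?B = "{t. \<nexists>m. (h has_real_derivative m) (at t)}"
  have "\<exists>q. \<forall>t\<in>?B. q t \<in> \<rat> \<and> L t < q t \<and> q t < R t"
    using strict Rats_dense_in_real by (intro bchoice ballI) (metis mem_Collect_eq)
  then obtain q where q: "\<And>t. t \<in> ?B \<Longrightarrow> q t \<in> \<rat> \<and> L t < q t \<and> q t < R t" by blast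
  have less: "q t < q t'" if "t \<in> ?B" "t' \<in> ?B" "t < t'" for t t'
    using q[OF that(1)] q[OF that(2)] R_le[OF that(3)] L_ge[OF that(3)] sym[of t t'] by linarith
  have "inj_on q ?B"
  proof (rule linorder_inj_onI')
    show "q i \<noteq> q j" if "i \<in> ?B" "j \<in> ?B" "i < j" for i j using less[OF that] by simp
  qed
  moreover have "countable (q ` ?B)"
    using q by (intro countable_subset[OF _ countable_rat] image_subsetI) simp
  ultimately show ?thesis by (metis countable_image_inj_on)
qed

section \<open>Directions without a gradient, and the norm at infinity\<close>

context plane_norm begin

definition bad_slopes :: "real set" where
  "bad_slopes = {t. \<nexists>m. ((\<lambda>s. N (vector [s, 1])) has_real_derivative m) (at t)}"

lemma countable_bad_slopes: "countable bad_slopes"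
  unfolding bad_slopes_def
proof (rule countable_not_differentiable_convex)
  show "convex_on UNIV (\<lambda>s. N (vector [s, 1]))"
  proof (rule convex_onI)
    fix t x y :: real assume t: "0 < t" "t < 1"
    have "vector [(1 - t) *\<^sub>R x + t *\<^sub>R y, 1] =
        (1 - t) *\<^sub>R (vector [x, 1] :: real^2) + t *\<^sub>R vector [y, 1]"
      by (simp add: vec_eq_real2)
    then show "N (vector [(1 - t) *\<^sub>R x + t *\<^sub>R y, 1]) \<le> (1 - t) * N (vector [x, 1]) + t * N (vector [y, 1])"
      using triangle[of "(1 - t) *\<^sub>R vector [x, 1]" "t *\<^sub>R vector [y, 1]"] t by (simp add: scale)
  qed simp
qed

lemma ex_has_grad:
  assumes "x$2 \<noteq> 0" "x$1 / x$2 \<notin> bad_slopes"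
  obtains c where "has_grad x c"
proof -
  obtain c where c: "has_grad (vector [x$1 / x$2, 1]) c"
    using assms(2) has_grad_line unfolding bad_slopes_def by blast
  show ?thesis
  proof (cases "x$2 > 0")
    case True
    have "x = x$2 *\<^sub>R vector [x$1 / x$2, 1]" using True by (simp add: vec_eq_real2)
    then show ?thesis using has_grad_scale[OF c True] that by metis
  next
    case False
    have "x = (- x$2) *\<^sub>R (- vector [x$1 / x$2, 1])" using assms(1) by (simp add: vec_eq_real2)
    then show ?thesis using has_grad_scale[OF has_grad_minus[OF c], of "- x$2"] that False assms(1)
      by (metis linorder_neqE_linordered_idom neg_0_less_iff_less)
  qed
qed

text \<open>Every line through 0 carries just two unit vectors, opposite to each other. The
  horizontal direction has no representative \<open>vector [t, 1]\<close> and is added to the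
  exceptional ones.\<close>

lemma countable_unit_no_grad: "countable {x. N x = 1 \<and> (\<nexists>c. has_grad x c)}"
proof (rule countable_subset)
  let ?f = "\<lambda>v::real^2. (1 / N v) *\<^sub>R v"
  let ?S = "(\<lambda>t. vector [t, 1]) ` bad_slopes \<union> {vector [1, 0] :: real^2}"
  show "countable (?f ` ?S \<union> uminus ` ?f ` ?S)"
    using countable_bad_slopes by auto
  show "{x. N x = 1 \<and> (\<nexists>c. has_grad x c)} \<subseteq> ?f ` ?S \<union> uminus ` ?f ` ?S"
  proof
    fix x :: "real^2" assume x: "x \<in> {x. N x = 1 \<and> (\<nexists>c. has_grad x c)}"
    have key: "x \<in> ?f ` ?S \<union> uminus ` ?f ` ?S" if "x = r *\<^sub>R v" "v \<in> ?S" for r v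
    proof -
      have "\<bar>r\<bar> * N v = 1" using x that(1) by (simp add: scale)
      then have "\<bar>r\<bar> = 1 / N v" by (metis nonzero_divide_eq_eq mult_zero_right zero_neq_one)
      then have "r = 1 / N v \<or> r = - (1 / N v)" by linarith
      then have "x = ?f v \<or> x = - ?f v" using that(1) by (metis scaleR_minus_left)
      then show ?thesis using that(2) by blast
    qed
    show "x \<in> ?f ` ?S \<union> uminus ` ?f ` ?S"
    proof (cases "x$2 = 0")
      case True
      then have "x = (x$1) *\<^sub>R vector [1, 0]" by (simp add: vec_eq_real2)
      then show ?thesis by (rule key) simp
    next
      case False
      have "x$1 / x$2 \<in> bad_slopes" using ex_has_grad[OF False] x by blast
      moreover have "x = (x$2) *\<^sub>R vector [x$1 / x$2, 1]" using False by (simp add: vec_eq_real2)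
      ultimately show ?thesis by (intro key) auto
    qed
  qed
qed

text \<open>Convexity bounds the difference quotient at scale \<open>\<tau>\<close> by the one at a fixed larger scale \<open>t\<close>,
  and only the latter has to converge.\<close>

lemma horofunction_upper:
  fixes \<tau> :: "'i \<Rightarrow> real"
  assumes c: "has_grad v c" and \<tau>: "filterlim \<tau> (at_right 0) F" and R: "((\<lambda>i. \<tau> i *\<^sub>R R i) \<longlongrightarrow> v) F"
    and e: "c \<bullet> w < e"
  shows "\<forall>\<^sub>F i in F. N (R i + w) - N (R i) < e"
proof -
  have "((\<lambda>t. (N (v + t *\<^sub>R w) - N v) / t) \<longlongrightarrow> c \<bullet> w) (at_right 0)"
    by (rule tendsto_mono[OF at_le has_gradD[OF c]]) auto
  from order_tendstoD(2)[OF this e] have "\<forall>\<^sub>F t in at_right 0. (N (v + t *\<^sub>R w) - N v) / t < e \<and> 0 < t"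
    using eventually_at_right_less[of 0] by (rule eventually_conj)
  then obtain t where t: "(N (v + t *\<^sub>R w) - N v) / t < e" "0 < t"
    using eventually_happens[of _ "at_right (0::real)"] by auto
  have "((\<lambda>i. (N (\<tau> i *\<^sub>R R i + t *\<^sub>R w) - N (\<tau> i *\<^sub>R R i)) / t) \<longlongrightarrow> (N (v + t *\<^sub>R w) - N v) / t) F"
    using t(2) by (intro tendsto_intros R) simp
  from order_tendstoD(2)[OF this t(1)]
  have 1: "\<forall>\<^sub>F i in F. (N (\<tau> i *\<^sub>R R i + t *\<^sub>R w) - N (\<tau> i *\<^sub>R R i)) / t < e" .
  have "\<forall>\<^sub>F s in at_right 0. s \<in> {0<..<t}" using t(2) by (rule eventually_at_right_real)
  then have 2: "\<forall>\<^sub>F i in F. \<tau> i \<in> {0<..<t}"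
    using \<tau> by (rule eventually_compose_filterlim)
  from 1 2 show ?thesis
  proof eventually_elim
    case (elim i)
    \<comment> \<open>With this weight the rescaled \<open>R i + w\<close> is a convex combination
      of the rescaled \<open>R i\<close> and its translate by t w.\<close>
    define l where "l = \<tau> i / t"
    have l: "0 < l" "l < 1" "l * t = \<tau> i" using elim t(2) by (auto simp: l_def)
    have "\<tau> i *\<^sub>R (R i + w) = (1 - l) *\<^sub>R (\<tau> i *\<^sub>R R i) + l *\<^sub>R (\<tau> i *\<^sub>R R i + t *\<^sub>R w)"
      by (simp add: algebra_simps flip: l(3))
    then have "N (\<tau> i *\<^sub>R (R i + w)) \<le> N ((1 - l) *\<^sub>R (\<tau> i *\<^sub>R R i)) + N (l *\<^sub>R (\<tau> i *\<^sub>R R i + t *\<^sub>R w))"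
      using triangle by metis
    then have "\<tau> i * N (R i + w) \<le> (1 - l) * (\<tau> i * N (R i)) + l * N (\<tau> i *\<^sub>R R i + t *\<^sub>R w)"
      using elim l by (simp add: scale)
    then have "\<tau> i * (N (R i + w) - N (R i)) \<le> l * (N (\<tau> i *\<^sub>R R i + t *\<^sub>R w) - \<tau> i * N (R i))"
      by (simp add: algebra_simps)
    also have "\<dots> = \<tau> i * ((N (\<tau> i *\<^sub>R R i + t *\<^sub>R w) - N (\<tau> i *\<^sub>R R i)) / t)"
      using elim by (simp add: scale l_def)
    finally have "\<tau> i * (N (R i + w) - N (R i)) \<le>
        \<tau> i * ((N (\<tau> i *\<^sub>R R i + t *\<^sub>R w) - N (\<tau> i *\<^sub>R R i)) / t)" .
    then have "N (R i + w) - N (R i) \<le> (N (\<tau> i *\<^sub>R R i + t *\<^sub>R w) - N (\<tau> i *\<^sub>R R i)) / t"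
      by (rule mult_left_le_imp_le) (use elim in simp)
    then show ?case using elim by simp
  qed
qed

text \<open>The upper bound for -w turns into a lower bound for w, because convexity gives 2 N R <=
  N (R + w) + N (R - w). The limit is the horofunction of the direction v; no rate is required for
  the convergence of the directions, and none is available where this is applied to images under
  f.\<close>

lemma tendsto_horofunction:
  fixes \<tau> :: "'i \<Rightarrow> real"
  assumes "has_grad v c" "filterlim \<tau> (at_right 0) F" "((\<lambda>i. \<tau> i *\<^sub>R R i) \<longlongrightarrow> v) F"
  shows "((\<lambda>i. N (R i + w) - N (R i)) \<longlongrightarrow> c \<bullet> w) F"
proof (rule order_tendstoI)
  show "\<forall>\<^sub>F i in F. N (R i + w) - N (R i) < a" if "c \<bullet> w < a" for a
    using horofunction_upper[OF assms that] .
  show "\<forall>\<^sub>F i in F. a < N (R i + w) - N (R i)" if "a < c \<bullet> w" for a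
  proof -
    have "\<forall>\<^sub>F i in F. N (R i + - w) - N (R i) < - a"
      by (rule horofunction_upper[OF assms]) (use that in simp)
    then show ?thesis
    proof eventually_elim
      case (elim i)
      have "N ((R i + w) + (R i + - w)) \<le> N (R i + w) + N (R i + - w)" by (rule triangle)
      moreover have "(R i + w) + (R i + - w) = 2 *\<^sub>R R i" by (simp add: scaleR_2)
      ultimately show ?case using elim by (simp only: scale)
    qed
  qed
qed

end

lemma (in plane_norm) dense_approx:
  assumes "closure V = UNIV" "e > 0"
  obtains y where "y \<in> V" "N (y - x) < e"
proof -
  have "x \<in> {z. N (z - x) < e} \<inter> closure V" using assms by simp
  then have "{z. N (z - x) < e} \<inter> V \<noteq> {}"
    using open_Int_closure_eq_empty[OF open_ball[of x e], of V] by blast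
  then show ?thesis using that by auto
qed

section \<open>Asymptotics of step isometries\<close>

locale step_isometry = plane_norm +
  fixes V :: "(real^2) set" and f :: "real^2 \<Rightarrow> real^2"
  assumes dense: "closure V = UNIV"
    and f_in: "x \<in> V \<Longrightarrow> f x \<in> V"
    and step: "\<lbrakk>x \<in> V; y \<in> V; 2 \<le> k\<rbrakk> \<Longrightarrow> N (f x - f y) < of_int k \<longleftrightarrow> N (x - y) < of_int k"
begin

text \<open>f is controlled only on V, so arguments are rounded to V. The precision 1 is arbitrary:
  rescaling removes bounded errors.\<close>

definition rnd :: "real^2 \<Rightarrow> real^2" where
  "rnd x = (SOME y. y \<in> V \<and> N (y - x) < 1)"

lemma rnd: "rnd x \<in> V" "N (rnd x - x) < 1"
proof -
  have "\<exists>y. y \<in> V \<and> N (y - x) < 1" using dense_approx[OF dense, of 1 x] by auto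
  from someI_ex[OF this] show "rnd x \<in> V" "N (rnd x - x) < 1" by (auto simp: rnd_def)
qed

lemma almost_isometry:
  assumes "x \<in> V" "y \<in> V" shows "\<bar>N (f x - f y) - N (x - y)\<bar> \<le> 2"
proof -
  \<comment> \<open>The least threshold k >= 2 above a is at most a + 2; it is the cut-off at 2 that
    raises the error from 1 to 2.\<close>
  have up: "b \<le> a + 2" if "0 \<le> a" "\<And>k. 2 \<le> k \<Longrightarrow> a < of_int k \<Longrightarrow> b < of_int k" for a b :: real
  proof -
    have "b < of_int (max 2 (\<lfloor>a\<rfloor> + 1))" by (intro that(2)) linarith+
    also have "\<dots> \<le> a + 2" using that(1) by linarith
    finally show ?thesis by simp
  qed
  show ?thesis
    using up[of "N (x - y)" "N (f x - f y)"] up[of "N (f x - f y)" "N (x - y)"] step[OF assms]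
    by (auto simp: abs_le_iff)
qed

definition F :: "nat \<Rightarrow> real^2 \<Rightarrow> real^2" where
  "F n u = (1 / real n) *\<^sub>R f (rnd (real n *\<^sub>R u))"

text \<open>Rounding costs at most 1 at either end and f distorts by at most 2, which is 4 before
  division by n.\<close>

lemma F_almost_isometry: "\<bar>N (F n u - F n v) - N (u - v)\<bar> \<le> 4 / real n" if "n > 0"
proof -
  let ?x = "rnd (real n *\<^sub>R u)" and ?y = "rnd (real n *\<^sub>R v)"
  have "\<bar>N (?x - ?y) - N (real n *\<^sub>R u - real n *\<^sub>R v)\<bar> \<le> N ((?x - ?y) - (real n *\<^sub>R u - real n *\<^sub>R v))"
    by (rule abs_diff_le)
  also have "\<dots> \<le> N (?x - real n *\<^sub>R u) + N (?y - real n *\<^sub>R v)"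
    using triangle_diff[of "?x - real n *\<^sub>R u" "?y - real n *\<^sub>R v" 0]
      triangle[of "?x - real n *\<^sub>R u" "- (?y - real n *\<^sub>R v)"] minus[of "?y - real n *\<^sub>R v"]
    by (simp add: algebra_simps)
  also have "\<dots> \<le> 2" using rnd(2)[of "real n *\<^sub>R u"] rnd(2)[of "real n *\<^sub>R v"] by simp
  finally have "\<bar>N (f ?x - f ?y) - N (real n *\<^sub>R u - real n *\<^sub>R v)\<bar> \<le> 4"
    using almost_isometry[OF rnd(1) rnd(1), of "real n *\<^sub>R u" "real n *\<^sub>R v"] by linarith
  moreover have "N (real n *\<^sub>R u - real n *\<^sub>R v) = real n * N (u - v)"
    using scale[of "real n" "u - v"] by (simp add: algebra_simps)
  moreover have "N (f ?x - f ?y) = real n * N (F n u - F n v)"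
  proof -
    have "f ?x - f ?y = real n *\<^sub>R (F n u - F n v)" using that by (simp add: F_def algebra_simps)
    then show ?thesis by (simp add: scale)
  qed
  ultimately have "\<bar>real n * (N (F n u - F n v) - N (u - v))\<bar> \<le> 4" by (simp add: algebra_simps)
  then have "real n * \<bar>N (F n u - F n v) - N (u - v)\<bar> \<le> 4" by (simp add: abs_mult)
  then show ?thesis using that by (simp add: field_simps)
qed

text \<open>The rescalings \<open>F n\<close> need not converge; by Tychonoff's theorem they have a cluster point,
  which is their limit along a filter finer than \<open>sequentially\<close>.\<close>

lemma asymptotic_isometry:
  obtains H U where "H \<noteq> bot" "H \<le> sequentially" "\<And>u. ((\<lambda>n. F n u) \<longlongrightarrow> U u) H"
    "\<And>u v. N (U u - U v) = N (u - v)"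
proof -
  \<comment> \<open>The summands bound \<open>N u\<close>, the error 4 / n, and
    \<open>F n 0\<close>, which is \<open>F 1 0\<close> divided by n.\<close>
  define B where "B u = N u + 4 + N (F 1 0)" for u
  define K where "K = (PiE UNIV (\<lambda>u. {z. N z \<le> B u}))"
  have "compactin (product_topology (\<lambda>_. euclidean) UNIV) K"
    unfolding K_def compactin_PiE using compact_ball by simp
  then have K: "compact K" by (simp add: euclidean_product_topology)
  have F_K: "F n \<in> K" if "n > 0" for n
  proof -
    have "N (F n u) \<le> B u" for u
    proof -
      have "N (F n u) \<le> N (F n u - F n 0) + N (F n 0)" using triangle_diff[of "F n u" 0 "F n 0"] by simp
      moreover have "N (F n u - F n 0) \<le> N u + 4 / real n" using F_almost_isometry[OF that, of u 0] by simp
      moreover have "4 / real n \<le> 4" using that by (simp add: field_simps)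
      moreover have "N (F n 0) \<le> N (F 1 0)"
      proof -
        have "F n 0 = (1 / real n) *\<^sub>R F 1 0" by (simp add: F_def)
        then have "N (F n 0) = 1 / real n * N (F 1 0)" by (simp add: scale)
        also have "\<dots> \<le> 1 * N (F 1 0)" using that by (intro mult_right_mono) auto
        finally show ?thesis by simp
      qed
      ultimately show ?thesis by (simp add: B_def)
    qed
    then show ?thesis by (auto simp: K_def)
  qed
  have "\<forall>\<^sub>F g in filtermap F sequentially. g \<in> K"
    unfolding eventually_filtermap using F_K by (intro eventually_sequentiallyI[of 1]) auto
  moreover have "filtermap F sequentially \<noteq> bot" by (simp add: filtermap_bot_iff)
  ultimately obtain U where U: "inf (nhds U) (filtermap F sequentially) \<noteq> bot"
    using K unfolding compact_filter by blast
  \<comment> \<open>The filter of indices n for which \<open>F n\<close> is close to U pointwise; it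
    is nontrivial just because U is a cluster point.\<close>
  define H where "H = inf sequentially (filtercomap F (nhds U))"
  have "H \<noteq> bot"
  proof
    assume "H = bot"
    then have "\<forall>\<^sub>F n in H. False" by simp
    then obtain P Q where PQ: "eventually P sequentially" "eventually Q (filtercomap F (nhds U))"
      "\<And>n. P n \<Longrightarrow> Q n \<Longrightarrow> False"
      unfolding H_def eventually_inf by blast
    obtain S where S: "eventually S (nhds U)" "\<And>n. S (F n) \<Longrightarrow> Q n"
      using PQ(2) unfolding eventually_filtercomap by blast
    have "eventually (\<lambda>g. \<not> S g) (filtermap F sequentially)"
      unfolding eventually_filtermap using PQ(1) by (rule eventually_mono) (use PQ(3) S(2) in blast)
    then have "\<forall>\<^sub>F g in inf (nhds U) (filtermap F sequentially). False"
      unfolding eventually_inf using S(1) by blast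
    then show False using U by (simp add: trivial_limit_def)
  qed
  moreover have le: "H \<le> sequentially" by (simp add: H_def)
  moreover have lim: "((\<lambda>n. F n u) \<longlongrightarrow> U u) H" for u
  proof -
    have "filterlim F (nhds U) H"
      unfolding H_def by (rule filterlim_mono[OF filterlim_filtercomap]) auto
    from continuous_on_tendsto_compose[OF continuous_on_product_coordinates this]
    show ?thesis by simp
  qed
  moreover have "N (U u - U v) = N (u - v)" for u v
  proof (rule tendsto_unique[OF \<open>H \<noteq> bot\<close>])
    show "((\<lambda>n. N (F n u - F n v)) \<longlongrightarrow> N (U u - U v)) H"
      by (intro tendsto_intros lim)
    have "(\<lambda>n. 4 / real n) \<longlonglongrightarrow> 0" by (rule lim_const_over_n)
    then have "(\<lambda>n. N (F n u - F n v) - N (u - v)) \<longlonglongrightarrow> 0"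
      by (rule Lim_null_comparison[rotated])
        (auto intro!: eventually_sequentiallyI[of 1] F_almost_isometry[simplified])
    then have "(\<lambda>n. N (F n u - F n v)) \<longlonglongrightarrow> N (u - v)" by (simp add: LIM_zero_iff)
    then show "((\<lambda>n. N (F n u - F n v)) \<longlongrightarrow> N (u - v)) H" by (rule tendsto_mono[OF le])
  qed
  ultimately show ?thesis using that by blast
qed

text \<open>Seen from points \<open>y\<close> far away in direction \<open>u\<close>, the sets \<open>N (y - x) < k\<close> are nearly the half planes
  bounded by level lines of \<open>c\<close>, and \<open>f\<close> turns them into half planes bounded by level lines of \<open>c'\<close>.\<close>

lemma asymptotic_order:
  assumes u: "N u = 1" "has_grad u c" and u': "has_grad u' c'"
    and H: "H \<noteq> bot" "H \<le> sequentially" "((\<lambda>n. F n u) \<longlongrightarrow> u') H"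
    and x: "x \<in> V" "x' \<in> V" and less: "c \<bullet> x' + of_int j < c \<bullet> x"
  shows "c' \<bullet> f x' + of_int j \<le> c' \<bullet> f x"
proof -
  \<comment> \<open>The point \<open>y n\<close> is placed near \<open>s n\<close> times u. Its
    distances from x and x' are then about \<open>k n - 2 * e\<close> and
    \<open>k n + j + 2 * e\<close>, so the thresholds \<open>k n\<close> and \<open>k n + j\<close>
    are missed by the same margin on opposite sides.\<close>
  define e where "e = (c \<bullet> x - c \<bullet> x' - of_int j) / 4"
  have e: "e > 0" using less by (simp add: e_def)
  define k where "k n = \<lceil>real n - c \<bullet> x + 2 * e\<rceil>" for n
  define s where "s n = of_int (k n) + c \<bullet> x - 2 * e" for n
  have s: "real n \<le> s n" "s n \<le> real n + 1" for n
    unfolding s_def k_def by linarith+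
  have "\<exists>y. y \<in> V \<and> N (y - s n *\<^sub>R u) < 1 / real (Suc n)" for n
    using dense_approx[OF dense, of "1 / real (Suc n)" "s n *\<^sub>R u"] by auto
  then obtain y where y: "\<And>n. y n \<in> V" "\<And>n. N (y n - s n *\<^sub>R u) < 1 / real (Suc n)"
    by metis
  define \<tau> where "\<tau> n = 1 / real n" for n
  have \<tau>0: "\<tau> \<longlonglongrightarrow> 0" unfolding \<tau>_def by (rule lim_1_over_n)
  have \<tau>: "filterlim \<tau> (at_right 0) sequentially"
    unfolding filterlim_at using \<tau>0 by (auto intro!: eventually_sequentiallyI[of 1] simp: \<tau>_def)
  have y_near: "N (y n - real n *\<^sub>R u) \<le> 2" for n
  proof -
    have "N (y n - real n *\<^sub>R u) \<le> N (y n - s n *\<^sub>R u) + N (s n *\<^sub>R u - real n *\<^sub>R u)" by (rule triangle_diff)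
    also have "N (s n *\<^sub>R u - real n *\<^sub>R u) = \<bar>s n - real n\<bar>"
      using scale[of "s n - real n" u] u(1) by (simp add: algebra_simps)
    also have "\<bar>s n - real n\<bar> \<le> 1" using s[of n] by simp
    also have "N (y n - s n *\<^sub>R u) \<le> 1" using y(2)[of n] by (rule less_imp_le[THEN order_trans]) simp
    finally show ?thesis by simp
  qed
  have null: "(\<lambda>n. \<tau> n * C) \<longlonglongrightarrow> 0" for C
    using tendsto_mult_left_zero[OF \<tau>0] .
  have y_lim: "(\<lambda>n. \<tau> n *\<^sub>R y n) \<longlonglongrightarrow> u"
  proof (rule tendstoI_N, rule Lim_null_comparison[OF _ null[of 2]])
    show "\<forall>\<^sub>F n in sequentially. norm (N (\<tau> n *\<^sub>R y n - u)) \<le> \<tau> n * 2"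
    proof (rule eventually_sequentiallyI[of 1])
      fix n :: nat assume "1 \<le> n"
      then have "\<tau> n *\<^sub>R y n - u = \<tau> n *\<^sub>R (y n - real n *\<^sub>R u)" by (simp add: \<tau>_def algebra_simps)
      then show "norm (N (\<tau> n *\<^sub>R y n - u)) \<le> \<tau> n * 2"
        using y_near[of n] by (simp add: scale \<tau>_def divide_right_mono)
    qed
  qed
  have Ny: "(\<lambda>n. N (y n) - s n) \<longlonglongrightarrow> 0"
  proof (rule Lim_null_comparison)
    show "\<forall>\<^sub>F n in sequentially. norm (N (y n) - s n) \<le> 1 / real (Suc n)"
    proof (rule eventually_sequentiallyI[of 0])
      fix n :: nat
      have "N (s n *\<^sub>R u) = s n" using s(1)[of n] u(1) by (simp add: scale)
      then show "norm (N (y n) - s n) \<le> 1 / real (Suc n)"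
        using abs_diff_le[of "y n" "s n *\<^sub>R u"] y(2)[of n] by simp
    qed
  qed (rule LIMSEQ_Suc[OF lim_1_over_n])
  have dist_lim: "(\<lambda>n. N (y n - z) - of_int (k n)) \<longlonglongrightarrow> c \<bullet> x - c \<bullet> z - 2 * e" for z
  proof -
    have "(\<lambda>n. N (y n + (- z)) - N (y n)) \<longlonglongrightarrow> c \<bullet> (- z)"
      by (rule tendsto_horofunction[OF u(2) \<tau> y_lim])
    then have "(\<lambda>n. (N (y n + (- z)) - N (y n)) + (N (y n) - s n) + (c \<bullet> x - 2 * e)) \<longlonglongrightarrow>
        c \<bullet> (- z) + 0 + (c \<bullet> x - 2 * e)"
      by (intro tendsto_intros Ny)
    then show ?thesis by (simp add: s_def algebra_simps)
  qed
  have 1: "\<forall>\<^sub>F n in sequentially. N (y n - x) - of_int (k n) < 0"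
    by (rule order_tendstoD(2)[OF dist_lim]) (use e in simp)
  have 2: "\<forall>\<^sub>F n in sequentially. of_int j < N (y n - x') - of_int (k n)"
    by (rule order_tendstoD(1)[OF dist_lim]) (use e in \<open>simp add: e_def field_simps\<close>)
  \<comment> \<open>Both thresholds have to be at least 2 for f to preserve them.\<close>
  have 3: "\<forall>\<^sub>F n in sequentially. 2 + \<bar>j\<bar> \<le> k n"
  proof -
    have "\<forall>\<^sub>F n in sequentially. real_of_int (2 + \<bar>j\<bar>) + c \<bullet> x \<le> real n"
      using filterlim_real_sequentially unfolding filterlim_at_top by blast
    then show ?thesis
      by eventually_elim (use e in \<open>unfold k_def, linarith\<close>)
  qed
  from 1 2 3 have "\<forall>\<^sub>F n in sequentially. of_int j \<le> N (f (y n) - f x') - N (f (y n) - f x)"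
  proof eventually_elim
    case (elim n)
    have "N (f (y n) - f x) < of_int (k n)"
      using step[OF y(1) x(1), of "k n" n] elim by simp
    moreover have "\<not> N (f (y n) - f x') < of_int (k n + j)"
      using step[OF y(1) x(2), of "k n + j" n] elim by simp
    ultimately show ?case by simp
  qed
  then have ev: "\<forall>\<^sub>F n in H. of_int j \<le> N (f (y n) - f x') - N (f (y n) - f x)"
    by (rule filter_leD[OF H(2)])
  \<comment> \<open>\<open>y n\<close> is within 3 of the rounded point used in
    \<open>F n u\<close>, so the images are within 5 of each other and have the same rescaled
    limit.\<close>
  have "(\<lambda>n. \<tau> n *\<^sub>R f (y n) - F n u) \<longlonglongrightarrow> 0"
  proof (rule tendstoI_N, rule Lim_null_comparison[OF _ null[of 5]])
    show "\<forall>\<^sub>F n in sequentially. norm (N (\<tau> n *\<^sub>R f (y n) - F n u - 0)) \<le> \<tau> n * 5"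
    proof (rule eventually_sequentiallyI[of 1])
      fix n :: nat
      have "N (y n - rnd (real n *\<^sub>R u)) \<le> 3"
        using triangle_diff[of "y n" "rnd (real n *\<^sub>R u)" "real n *\<^sub>R u"] y_near[of n] rnd(2)[of "real n *\<^sub>R u"]
          minus_commute[of "real n *\<^sub>R u" "rnd (real n *\<^sub>R u)"] by simp
      then have "N (f (y n) - f (rnd (real n *\<^sub>R u))) \<le> 5"
        using almost_isometry[OF y(1)[of n] rnd(1)[of "real n *\<^sub>R u"]] by simp
      moreover have "\<tau> n *\<^sub>R f (y n) - F n u = \<tau> n *\<^sub>R (f (y n) - f (rnd (real n *\<^sub>R u)))"
        by (simp add: \<tau>_def F_def algebra_simps)
      ultimately show "norm (N (\<tau> n *\<^sub>R f (y n) - F n u - 0)) \<le> \<tau> n * 5"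
        by (simp add: scale \<tau>_def divide_right_mono)
    qed
  qed
  from tendsto_add[OF tendsto_mono[OF H(2) this] H(3)]
  have fy: "((\<lambda>n. \<tau> n *\<^sub>R f (y n)) \<longlongrightarrow> u') H" by simp
  have \<tau>H: "filterlim \<tau> (at_right 0) H" using \<tau> H(2) by (rule filterlim_mono[OF _ order_refl])
  have lim: "((\<lambda>n. N (f (y n) + - z) - N (f (y n))) \<longlongrightarrow> c' \<bullet> (- z)) H" for z
    by (rule tendsto_horofunction[OF u' \<tau>H fy])
  have "((\<lambda>n. N (f (y n) - f x') - N (f (y n) - f x)) \<longlongrightarrow> c' \<bullet> f x - c' \<bullet> f x') H"
    using tendsto_diff[OF lim[of "f x'"] lim[of "f x"]] by simp
  from tendsto_lowerbound[OF this ev H(1)] show ?thesis by simp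
qed

end

section \<open>Rigidity\<close>

lemma dense_meets_open:
  assumes "closure V = UNIV" "open W" "W \<noteq> {}"
  obtains x where "x \<in> V" "x \<in> W"
  using assms open_Int_closure_eq_empty[of W V] by auto

text \<open>The left limits \<open>G\<close> of the monotone relations \<open>q\<^sub>i\<close> versus \<open>p\<^sub>i\<close> satisfy the Pexider equation
  \<open>G\<^sub>3 (s + t) = G\<^sub>1 s + G\<^sub>2 t\<close>, and a solution at bounded distance from the identity is a translation.\<close>

lemma pexider_shift:
  fixes p1 p2 q1 q2 :: "'a \<Rightarrow> real"
  assumes dense: "\<And>s1 t1 s2 t2. \<lbrakk>s1 < t1; s2 < t2\<rbrakk> \<Longrightarrow> \<exists>x\<in>V. s1 < p1 x \<and> p1 x < t1 \<and> s2 < p2 x \<and> p2 x < t2"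
    and mono1: "\<And>x y. \<lbrakk>x \<in> V; y \<in> V; p1 x < p1 y\<rbrakk> \<Longrightarrow> q1 x \<le> q1 y"
    and mono2: "\<And>x y. \<lbrakk>x \<in> V; y \<in> V; p2 x < p2 y\<rbrakk> \<Longrightarrow> q2 x \<le> q2 y"
    and mono3: "\<And>x y. \<lbrakk>x \<in> V; y \<in> V; p1 x + p2 x < p1 y + p2 y\<rbrakk> \<Longrightarrow> q1 x + q2 x \<le> q1 y + q2 y"
    and bd1: "\<And>x y. \<lbrakk>x \<in> V; y \<in> V\<rbrakk> \<Longrightarrow> \<bar>(q1 x - q1 y) - (p1 x - p1 y)\<bar> \<le> B"
    and bd2: "\<And>x y. \<lbrakk>x \<in> V; y \<in> V\<rbrakk> \<Longrightarrow> \<bar>(q2 x - q2 y) - (p2 x - p2 y)\<bar> \<le> B"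
  obtains d where "\<And>x. x \<in> V \<Longrightarrow> q1 x = p1 x + d"
proof -
  obtain x0 where x0: "x0 \<in> V" using dense[of 0 1 0 1] by auto
  define p3 where "p3 x = p1 x + p2 x" for x
  define q3 where "q3 x = q1 x + q2 x" for x
  define G where "G p q s = (SUP x\<in>{x \<in> V. p x < s}. q x)" for p q :: "'a \<Rightarrow> real" and s
  have bdd: "bdd_above (q ` {x \<in> V. p x < s})"
    if "\<And>x y. \<lbrakk>x \<in> V; y \<in> V\<rbrakk> \<Longrightarrow> \<bar>(q x - q y) - (p x - p y)\<bar> \<le> C" for p q :: "'a \<Rightarrow> real" and s C
  proof (rule bdd_aboveI2)
    show "q x \<le> q x0 - p x0 + s + C" if "x \<in> {x \<in> V. p x < s}" for x
      using \<open>\<And>x y. \<lbrakk>x \<in> V; y \<in> V\<rbrakk> \<Longrightarrow> \<bar>(q x - q y) - (p x - p y)\<bar> \<le> C\<close>[of x x0] x0 that by auto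
  qed
  have bd3: "\<bar>(q3 x - q3 y) - (p3 x - p3 y)\<bar> \<le> B + B" if "x \<in> V" "y \<in> V" for x y
    using bd1[OF that] bd2[OF that] unfolding p3_def q3_def by linarith
  have le1: "q1 x \<le> G p1 q1 s" if "x \<in> V" "p1 x < s" for x s
    unfolding G_def using that by (intro cSUP_upper bdd[OF bd1]) auto
  have le2: "q2 x \<le> G p2 q2 s" if "x \<in> V" "p2 x < s" for x s
    unfolding G_def using that by (intro cSUP_upper bdd[OF bd2]) auto
  have le3: "q3 x \<le> G p3 q3 s" if "x \<in> V" "p3 x < s" for x s
    unfolding G_def using that by (intro cSUP_upper bdd[OF bd3]) auto
  have ne: "{x \<in> V. p1 x < s} \<noteq> {}" "{x \<in> V. p2 x < s} \<noteq> {}" "{x \<in> V. p3 x < s} \<noteq> {}" for s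
  proof -
    show "{x \<in> V. p1 x < s} \<noteq> {}" "{x \<in> V. p2 x < s} \<noteq> {}"
      using dense[of "s - 1" s "s - 1" s] by auto
    obtain x where "x \<in> V" "p1 x < s / 2" "p2 x < s / 2"
      using dense[of "s / 2 - 1" "s / 2" "s / 2 - 1" "s / 2"] by auto
    then show "{x \<in> V. p3 x < s} \<noteq> {}" unfolding p3_def by (auto intro!: exI[of _ x])
  qed
  have G1_le: "G p1 q1 s \<le> b" if "\<And>x. \<lbrakk>x \<in> V; p1 x < s\<rbrakk> \<Longrightarrow> q1 x \<le> b" for s b
    unfolding G_def using that by (intro cSUP_least ne) auto
  have G2_le: "G p2 q2 s \<le> b" if "\<And>x. \<lbrakk>x \<in> V; p2 x < s\<rbrakk> \<Longrightarrow> q2 x \<le> b" for s b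
    unfolding G_def using that by (intro cSUP_least ne) auto
  have G3_le: "G p3 q3 s \<le> b" if "\<And>x. \<lbrakk>x \<in> V; p3 x < s\<rbrakk> \<Longrightarrow> q3 x \<le> b" for s b
    unfolding G_def using that by (intro cSUP_least ne) auto
  \<comment> \<open>For "<=", density yields x with p1 x so close below s and p2 x so close below t
    that p3 x exceeds p3 z. For ">=", it yields a single z above x in p1 and above y in p2.\<close>
  have G_add: "G p3 q3 (s + t) = G p1 q1 s + G p2 q2 t" for s t
  proof (rule antisym)
    show "G p3 q3 (s + t) \<le> G p1 q1 s + G p2 q2 t"
    proof (rule G3_le)
      fix z assume z: "z \<in> V" "p3 z < s + t"
      define e where "e = (s + t - p3 z) / 2"
      obtain x where x: "x \<in> V" "s - e < p1 x" "p1 x < s" "t - e < p2 x" "p2 x < t"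
        using dense[of "s - e" s "t - e" t] z(2) by (auto simp: e_def)
      have "s + t - p3 z = 2 * e" by (simp add: e_def)
      then have "p3 z < p3 x" using x(2,4) unfolding p3_def[of x] by linarith
      then have "q3 z \<le> q3 x" using mono3[OF z(1) x(1)] by (simp add: p3_def q3_def)
      also have "\<dots> \<le> G p1 q1 s + G p2 q2 t"
        using le1[OF x(1,3)] le2[OF x(1,5)] by (simp add: q3_def)
      finally show "q3 z \<le> G p1 q1 s + G p2 q2 t" .
    qed
    have "q1 x + q2 y \<le> G p3 q3 (s + t)" if xy: "x \<in> V" "p1 x < s" "y \<in> V" "p2 y < t" for x y
    proof -
      obtain z where z: "z \<in> V" "p1 x < p1 z" "p1 z < s" "p2 y < p2 z" "p2 z < t"
        using dense[OF xy(2,4)] by auto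
      have "q1 x + q2 y \<le> q3 z"
        using mono1[OF xy(1) z(1,2)] mono2[OF xy(3) z(1,4)] by (simp add: q3_def)
      also have "\<dots> \<le> G p3 q3 (s + t)" using z by (intro le3) (auto simp: p3_def)
      finally show ?thesis .
    qed
    then have "G p1 q1 s \<le> G p3 q3 (s + t) - q2 y" if "y \<in> V" "p2 y < t" for y
      using that by (intro G1_le) (simp add: le_diff_eq)
    then have "G p2 q2 t \<le> G p3 q3 (s + t) - G p1 q1 s"
      by (intro G2_le) (simp add: le_diff_eq add.commute)
    then show "G p1 q1 s + G p2 q2 t \<le> G p3 q3 (s + t)" by simp
  qed
  \<comment> \<open>The deviation of the first left limit from a translation. By the Pexider
    equation D is additive, and a bounded additive function vanishes because D (m s) = m D
    s.\<close>
  define D where "D s = G p1 q1 s - G p1 q1 0 - s" for s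
  have D_add: "D (s + t) = D s + D t" for s t
    using G_add[of "s + t" 0] G_add[of s t] G_add[of 0 t] G_add[of t 0] by (simp add: D_def)
  have D0: "D 0 = 0" by (simp add: D_def)
  have D_nat: "D (real n * s) = real n * D s" for n s
    by (induction n) (simp_all add: D0 D_add distrib_right)
  have G1_bd: "\<bar>G p1 q1 s - s - (q1 x0 - p1 x0)\<bar> \<le> B + 1" for s
  proof -
    have "G p1 q1 s \<le> q1 x0 - p1 x0 + s + B"
    proof (rule G1_le)
      fix x assume "x \<in> V" "p1 x < s"
      then show "q1 x \<le> q1 x0 - p1 x0 + s + B" using bd1[OF _ x0, of x] by auto
    qed
    moreover obtain x where "x \<in> V" "s - 1 < p1 x" "p1 x < s" using dense[of "s - 1" s 0 1] by auto
    then have "q1 x0 - p1 x0 + s - 1 - B \<le> G p1 q1 s"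
      using bd1[OF _ x0, of x] le1[of x s] by auto
    ultimately show ?thesis by (simp add: abs_le_iff)
  qed
  have D_zero: "D s = 0" for s
  proof -
    have bound: "\<bar>D r\<bar> \<le> 2 * (B + 1)" for r
      using G1_bd[of r] G1_bd[of 0] unfolding D_def by (smt (verit))
    have "\<bar>D s\<bar> = 0"
    proof (rule real_archimedian_rdiv_eq_0)
      show "real m * \<bar>D s\<bar> \<le> 2 * (B + 1)" for m
        using bound[of "real m * s"] by (simp add: D_nat abs_mult)
    qed auto
    then show ?thesis by simp
  qed
  have G1: "G p1 q1 s = s + G p1 q1 0" for s using D_zero[of s] by (simp add: D_def)
  \<comment> \<open>Monotonicity squeezes q1 x between G at p1 x and G slightly to the right of it;
    as G is now known to be a translation, the bounds agree.\<close>
  have "q1 x = p1 x + G p1 q1 0" if "x \<in> V" for x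
  proof (rule antisym)
    show "q1 x \<le> p1 x + G p1 q1 0"
    proof (rule field_le_epsilon)
      fix e :: real assume "e > 0"
      then have "q1 x \<le> G p1 q1 (p1 x + e)" using that by (intro le1) auto
      then show "q1 x \<le> p1 x + G p1 q1 0 + e" using G1[of "p1 x + e"] by simp
    qed
    have "G p1 q1 (p1 x) \<le> q1 x" by (rule G1_le) (rule mono1[OF _ that])
    then show "p1 x + G p1 q1 0 \<le> q1 x" using G1[of "p1 x"] by simp
  qed
  then show ?thesis by (rule that)
qed

lemma dense_bounded_inner_zero:
  fixes p :: "'a::real_inner"
  assumes V: "closure V = UNIV" and bd: "\<And>x y. \<lbrakk>x \<in> V; y \<in> V\<rbrakk> \<Longrightarrow> \<bar>p \<bullet> x - p \<bullet> y\<bar> \<le> B"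
  shows "p = 0"
proof (rule ccontr)
  assume p: "p \<noteq> 0"
  obtain y where y: "y \<in> V" using dense_meets_open[OF V open_UNIV] by auto
  have "open {z. p \<bullet> z > p \<bullet> y + B}" by (rule open_halfspace_gt)
  moreover have "{z. p \<bullet> z > p \<bullet> y + B} \<noteq> {}"
  proof -
    have "p \<bullet> (((p \<bullet> y + B + 1) / (p \<bullet> p)) *\<^sub>R p) = p \<bullet> y + B + 1" using p by simp
    then have "((p \<bullet> y + B + 1) / (p \<bullet> p)) *\<^sub>R p \<in> {z. p \<bullet> z > p \<bullet> y + B}" by simp
    then show ?thesis by blast
  qed
  ultimately obtain x where "x \<in> V" "p \<bullet> x > p \<bullet> y + B"
    using dense_meets_open[OF V] by blast
  with bd[OF this(1) y] show False by auto
qed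

text \<open>The integer shifts make the monotonicity quantitative: differences of e after f deviate
  from those of c by at most 1. The conclusion is a weak inequality because it comes from a
  limit.\<close>

definition order_preserving :: "(real^2) set \<Rightarrow> (real^2 \<Rightarrow> real^2) \<Rightarrow> real^2 \<Rightarrow> real^2 \<Rightarrow> bool" where
  "order_preserving V f c e \<longleftrightarrow>
     (\<forall>x\<in>V. \<forall>y\<in>V. \<forall>j::int. c \<bullet> y + of_int j < c \<bullet> x \<longrightarrow> e \<bullet> f y + of_int j \<le> e \<bullet> f x)"

lemma order_preservingD:
  assumes "order_preserving V f c e" "x \<in> V" "y \<in> V"
  shows "c \<bullet> y < c \<bullet> x \<Longrightarrow> e \<bullet> f y \<le> e \<bullet> f x"
    and "\<bar>(e \<bullet> f x - e \<bullet> f y) - (c \<bullet> x - c \<bullet> y)\<bar> \<le> 1"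
proof -
  have *: "c \<bullet> y + of_int j < c \<bullet> x \<Longrightarrow> e \<bullet> f y + of_int j \<le> e \<bullet> f x" if "x \<in> V" "y \<in> V" for x y j
    using assms(1) that unfolding order_preserving_def by blast
  show "c \<bullet> y < c \<bullet> x \<Longrightarrow> e \<bullet> f y \<le> e \<bullet> f x" using *[OF assms(2,3), of 0] by simp
  have "c \<bullet> x - c \<bullet> y - 1 \<le> e \<bullet> f x - e \<bullet> f y" if "x \<in> V" "y \<in> V" for x y
  proof -
    \<comment> \<open>The largest integer strictly below the difference.\<close>
    have "c \<bullet> y + of_int (\<lceil>c \<bullet> x - c \<bullet> y\<rceil> - 1) < c \<bullet> x" by linarith
    from *[OF that this] show ?thesis by linarith
  qed
  from this[OF assms(2,3)] this[OF assms(3,2)]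
  show "\<bar>(e \<bullet> f x - e \<bullet> f y) - (c \<bullet> x - c \<bullet> y)\<bar> \<le> 1" by linarith
qed

text \<open>Since e after f follows c up to bounded error, a relation among the e makes the same
  combination of the c bounded on differences from the dense set V, and such a functional is
  0.\<close>

lemma order_preserving_relation:
  assumes V: "closure V = UNIV"
    and ord: "order_preserving V f c1 e1" "order_preserving V f c2 e2" "order_preserving V f c3 e3"
    and rel: "\<alpha> *\<^sub>R e1 + \<beta> *\<^sub>R e2 + \<gamma> *\<^sub>R e3 = 0"
  shows "\<alpha> *\<^sub>R c1 + \<beta> *\<^sub>R c2 + \<gamma> *\<^sub>R c3 = 0" (is "?p = 0")
proof (rule dense_bounded_inner_zero[OF V])
  fix x y assume xy: "x \<in> V" "y \<in> V"
  define \<delta> where "\<delta> c e = (e \<bullet> f x - e \<bullet> f y) - (c \<bullet> x - c \<bullet> y)" for c e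
  have "(\<alpha> *\<^sub>R e1 + \<beta> *\<^sub>R e2 + \<gamma> *\<^sub>R e3) \<bullet> (f x - f y) = 0" using rel by simp
  then have "?p \<bullet> x - ?p \<bullet> y = - (\<alpha> * \<delta> c1 e1 + \<beta> * \<delta> c2 e2 + \<gamma> * \<delta> c3 e3)"
    by (simp add: \<delta>_def algebra_simps inner_simps)
  then have "\<bar>?p \<bullet> x - ?p \<bullet> y\<bar> \<le> \<bar>\<alpha> * \<delta> c1 e1\<bar> + \<bar>\<beta> * \<delta> c2 e2\<bar> + \<bar>\<gamma> * \<delta> c3 e3\<bar>" by linarith
  also have "\<dots> \<le> \<bar>\<alpha>\<bar> * 1 + \<bar>\<beta>\<bar> * 1 + \<bar>\<gamma>\<bar> * 1"
  proof -
    have "\<bar>\<delta> c1 e1\<bar> \<le> 1" "\<bar>\<delta> c2 e2\<bar> \<le> 1" "\<bar>\<delta> c3 e3\<bar> \<le> 1"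
      unfolding \<delta>_def by (rule order_preservingD(2)[OF ord(1) xy] order_preservingD(2)[OF ord(2) xy]
        order_preservingD(2)[OF ord(3) xy])+
    then show ?thesis unfolding abs_mult by (intro add_mono mult_left_mono abs_ge_zero)
  qed
  finally show "\<bar>?p \<bullet> x - ?p \<bullet> y\<bar> \<le> \<bar>\<alpha>\<bar> * 1 + \<bar>\<beta>\<bar> * 1 + \<bar>\<gamma>\<bar> * 1" .
qed

lemma order_preserving_scale:
  assumes "order_preserving V f c e" "x \<in> V" "y \<in> V"
  shows "a * (c \<bullet> y) < a * (c \<bullet> x) \<Longrightarrow> a * (e \<bullet> f y) \<le> a * (e \<bullet> f x)"
    and "\<bar>(a * (e \<bullet> f x) - a * (e \<bullet> f y)) - (a * (c \<bullet> x) - a * (c \<bullet> y))\<bar> \<le> \<bar>a\<bar>"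
proof -
  show "a * (e \<bullet> f y) \<le> a * (e \<bullet> f x)" if "a * (c \<bullet> y) < a * (c \<bullet> x)"
  proof (cases "a > 0")
    case True
    then show ?thesis using order_preservingD(1)[OF assms] that by auto
  next
    case False
    then have "c \<bullet> x < c \<bullet> y" using that by (auto simp: mult_less_cancel_left)
    from order_preservingD(1)[OF assms(1,3,2) this] False show ?thesis
      by (intro mult_left_mono_neg) auto
  qed
  have "(a * (e \<bullet> f x) - a * (e \<bullet> f y)) - (a * (c \<bullet> x) - a * (c \<bullet> y)) =
      a * ((e \<bullet> f x - e \<bullet> f y) - (c \<bullet> x - c \<bullet> y))" by (simp add: algebra_simps)
  then show "\<bar>(a * (e \<bullet> f x) - a * (e \<bullet> f y)) - (a * (c \<bullet> x) - a * (c \<bullet> y))\<bar> \<le> \<bar>a\<bar>"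
    using mult_left_mono[OF order_preservingD(2)[OF assms], of "\<bar>a\<bar>"] by (simp add: abs_mult)
qed

definition affine_on :: "(real^2) set \<Rightarrow> (real^2 \<Rightarrow> real^2) \<Rightarrow> bool" where
  "affine_on V f \<longleftrightarrow> (\<exists>p q r. \<forall>x\<in>V. f x = (x$1) *\<^sub>R p + (x$2) *\<^sub>R q + r)"

text \<open>Writing e3 = a e1 + b e2 gives c3 = a c1 + b c2, where a and b are nonzero because c3 is
  parallel to neither c1 nor c2. Thus a c1, b c2 and their sum are in the Pexider situation, and f
  is a translation in two independent pairs of coordinates.\<close>

lemma affine_on_if_order_preserving:
  assumes V: "closure V = UNIV"
    and ord: "order_preserving V f c1 e1" "order_preserving V f c2 e2" "order_preserving V f c3 e3"
    and e: "e1 \<noteq> 0" and c: "cross2 c1 c2 \<noteq> 0" "cross2 c1 c3 \<noteq> 0" "cross2 c2 c3 \<noteq> 0"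
  shows "affine_on V f"
proof -
  \<comment> \<open>A dependence between e1 and e2 would be inherited by c1 and c2.\<close>
  have e12: "cross2 e1 e2 \<noteq> 0"
  proof
    assume "cross2 e1 e2 = 0"
    then obtain k where "e2 = k *\<^sub>R e1" using cross2_eq_0E[OF _ e] by blast
    then have "(- k) *\<^sub>R c1 + 1 *\<^sub>R c2 + 0 *\<^sub>R c3 = 0"
      by (intro order_preserving_relation[OF V ord]) simp
    then have "c2 = k *\<^sub>R c1" by simp
    then show False using c(1) by (simp add: cross2_def algebra_simps)
  qed
  define a where "a = cross2 e3 e2 / cross2 e1 e2"
  define b where "b = cross2 e1 e3 / cross2 e1 e2"
  have e3: "e3 = a *\<^sub>R e1 + b *\<^sub>R e2" unfolding a_def b_def by (rule cross2_expand[OF e12])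
  then have "a *\<^sub>R c1 + b *\<^sub>R c2 + (- 1) *\<^sub>R c3 = 0"
    by (intro order_preserving_relation[OF V ord]) simp
  then have c3: "c3 = a *\<^sub>R c1 + b *\<^sub>R c2" by simp
  have ab: "a \<noteq> 0" "b \<noteq> 0" using c(2,3) unfolding c3 by (auto simp: cross2_def)
  have dense: "\<exists>x\<in>V. s1 < a * (c1 \<bullet> x) \<and> a * (c1 \<bullet> x) < t1 \<and> s2 < b * (c2 \<bullet> x) \<and> b * (c2 \<bullet> x) < t2"
    if "s1 < t1" "s2 < t2" for s1 t1 s2 t2
  proof -
    let ?W = "{x. s1 < a * (c1 \<bullet> x)} \<inter> {x. a * (c1 \<bullet> x) < t1} \<inter> {x. s2 < b * (c2 \<bullet> x)} \<inter> {x. b * (c2 \<bullet> x) < t2}"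
    obtain z where "c1 \<bullet> z = (s1 + t1) / 2 / a" "c2 \<bullet> z = (s2 + t2) / 2 / b"
      using cross2_nonzeroE[OF c(1)] by metis
    then have "z \<in> ?W" using that ab by simp
    moreover have "open ?W" by (intro open_Int open_Collect_less continuous_intros)
    ultimately show ?thesis using dense_meets_open[OF V, of ?W] by blast
  qed
  have mono3: "a * (e1 \<bullet> f x) + b * (e2 \<bullet> f x) \<le> a * (e1 \<bullet> f y) + b * (e2 \<bullet> f y)"
    if "x \<in> V" "y \<in> V" "a * (c1 \<bullet> x) + b * (c2 \<bullet> x) < a * (c1 \<bullet> y) + b * (c2 \<bullet> y)" for x y
    using order_preservingD(1)[OF ord(3) that(2,1)] that(3) by (simp add: c3 e3 inner_add_left)
  let ?B = "\<bar>a\<bar> + \<bar>b\<bar>"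
  have bd1: "\<bar>(a * (e1 \<bullet> f x) - a * (e1 \<bullet> f y)) - (a * (c1 \<bullet> x) - a * (c1 \<bullet> y))\<bar> \<le> ?B"
    and bd2: "\<bar>(b * (e2 \<bullet> f x) - b * (e2 \<bullet> f y)) - (b * (c2 \<bullet> x) - b * (c2 \<bullet> y))\<bar> \<le> ?B"
    if "x \<in> V" "y \<in> V" for x y
    using order_preserving_scale(2)[OF ord(1) that, of a] order_preserving_scale(2)[OF ord(2) that, of b]
    by linarith+
  have mono1: "a * (e1 \<bullet> f x) \<le> a * (e1 \<bullet> f y)" if "x \<in> V" "y \<in> V" "a * (c1 \<bullet> x) < a * (c1 \<bullet> y)" for x y
    by (rule order_preserving_scale(1)[OF ord(1) that(2,1,3)])
  have mono2: "b * (e2 \<bullet> f x) \<le> b * (e2 \<bullet> f y)" if "x \<in> V" "y \<in> V" "b * (c2 \<bullet> x) < b * (c2 \<bullet> y)" for x y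
    by (rule order_preserving_scale(1)[OF ord(2) that(2,1,3)])
  obtain d1 where d1: "\<And>x. x \<in> V \<Longrightarrow> a * (e1 \<bullet> f x) = a * (c1 \<bullet> x) + d1"
    using pexider_shift[where V = V, OF dense mono1 mono2 mono3 bd1 bd2] by blast
  obtain d2 where d2: "\<And>x. x \<in> V \<Longrightarrow> b * (e2 \<bullet> f x) = b * (c2 \<bullet> x) + d2"
  proof (rule pexider_shift[where V = V, OF _ mono2 mono1 _ bd2 bd1])
    show "\<exists>x\<in>V. s1 < b * (c2 \<bullet> x) \<and> b * (c2 \<bullet> x) < t1 \<and> s2 < a * (c1 \<bullet> x) \<and> a * (c1 \<bullet> x) < t2"
      if "s1 < t1" "s2 < t2" for s1 t1 s2 t2
      using dense[OF that(2,1)] by blast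
    show "b * (e2 \<bullet> f x) + a * (e1 \<bullet> f x) \<le> b * (e2 \<bullet> f y) + a * (e1 \<bullet> f y)"
      if "x \<in> V" "y \<in> V" "b * (c2 \<bullet> x) + a * (c1 \<bullet> x) < b * (c2 \<bullet> y) + a * (c1 \<bullet> y)" for x y
      using mono3[OF that(1,2)] that(3) by (simp add: add.commute)
    fix d assume "\<And>x. x \<in> V \<Longrightarrow> b * (e2 \<bullet> f x) = b * (c2 \<bullet> x) + d"
    then show thesis by (rule \<open>\<And>d2. (\<And>x. x \<in> V \<Longrightarrow> b * (e2 \<bullet> f x) = b * (c2 \<bullet> x) + d2) \<Longrightarrow> thesis\<close>)
  qed
  \<comment> \<open>p and q are the images of the unit vectors under the linear part, r is the
    translation, all given by their e1 and e2 coordinates.\<close>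
  obtain p where p: "e1 \<bullet> p = c1$1" "e2 \<bullet> p = c2$1" using cross2_nonzeroE[OF e12] by metis
  obtain q where q: "e1 \<bullet> q = c1$2" "e2 \<bullet> q = c2$2" using cross2_nonzeroE[OF e12] by metis
  obtain r where r: "e1 \<bullet> r = d1 / a" "e2 \<bullet> r = d2 / b" using cross2_nonzeroE[OF e12] by metis
  have "f x = (x$1) *\<^sub>R p + (x$2) *\<^sub>R q + r" if "x \<in> V" for x
  proof (rule cross2_inner_inj[OF e12])
    have "e1 \<bullet> f x = c1 \<bullet> x + d1 / a" "e2 \<bullet> f x = c2 \<bullet> x + d2 / b"
      using d1[OF that] d2[OF that] ab by (simp_all add: field_simps)
    then show "e1 \<bullet> f x = e1 \<bullet> ((x$1) *\<^sub>R p + (x$2) *\<^sub>R q + r)" "e2 \<bullet> f x = e2 \<bullet> ((x$1) *\<^sub>R p + (x$2) *\<^sub>R q + r)"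
      using p q r by (simp_all add: inner_add_right inner_real2[of _ x] algebra_simps)
  qed
  then show ?thesis unfolding affine_on_def by blast
qed

text \<open>An affine map is determined by its values at three noncollinear points of V, and these
  values lie in the countable set V. Restriction to V identifies maps that agree there.\<close>

lemma countable_affine_maps:
  assumes V: "countable V" "closure V = UNIV"
  shows "countable {restrict f V | f. f \<in> V \<rightarrow> V \<and> affine_on V f}" (is "countable ?H")
proof -
  obtain x0 where x0: "x0 \<in> V" using dense_meets_open[OF V(2) open_UNIV] by auto
  have "x0 + vector [1, 0] \<in> UNIV - {x0}" by (simp add: vec_eq_real2)
  then have "UNIV - {x0} \<noteq> {}" by blast
  then obtain x1 where x1: "x1 \<in> V" "x1 \<noteq> x0"
    using dense_meets_open[OF V(2), of "UNIV - {x0}"] by auto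
  define w where "w = x1 - x0"
  have w: "w \<noteq> 0" using x1 by (simp add: w_def)
  have "open {z. cross2 w (z - x0) \<noteq> 0}"
    unfolding cross2_def by (intro open_Collect_neq continuous_intros)
  \<comment> \<open>w turned by a right angle, so the determinant is the square of its
    length.\<close>
  moreover have "x0 + vector [- w$2, w$1] \<in> {z. cross2 w (z - x0) \<noteq> 0}"
  proof -
    have "w$1 * w$1 + w$2 * w$2 \<noteq> 0" using w by (simp add: sum_squares_eq_zero_iff vec_eq_real2)
    then show ?thesis by (simp add: cross2_def del: sum_squares_eq_zero_iff)
  qed
  ultimately obtain x2 where x2: "x2 \<in> V" "cross2 w (x2 - x0) \<noteq> 0"
    using dense_meets_open[OF V(2)] by blast
  define w' where "w' = x2 - x0"
  let ?e = "\<lambda>h::real^2 \<Rightarrow> real^2. (h x0, h x1, h x2)"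
  have "inj_on ?e ?H"
  proof (rule inj_onI)
    fix h h' assume "h \<in> ?H" "h' \<in> ?H" and eq: "?e h = ?e h'"
    then obtain f f' where f: "h = restrict f V" "h' = restrict f' V" "affine_on V f" "affine_on V f'" by blast
    obtain p q r where F: "\<And>x. x \<in> V \<Longrightarrow> f x = (x$1) *\<^sub>R p + (x$2) *\<^sub>R q + r"
      using f(3) unfolding affine_on_def by blast
    obtain p' q' r' where F': "\<And>x. x \<in> V \<Longrightarrow> f' x = (x$1) *\<^sub>R p' + (x$2) *\<^sub>R q' + r'"
      using f(4) unfolding affine_on_def by blast
    define P where "P = p - p'"
    define Q where "Q = q - q'"
    define R where "R = r - r'"
    have diff: "f x - f' x = (x$1) *\<^sub>R P + (x$2) *\<^sub>R Q + R" if "x \<in> V" for x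
      using F[OF that] F'[OF that] by (simp add: P_def Q_def R_def algebra_simps)
    have "f x0 = f' x0" "f x1 = f' x1" "f x2 = f' x2" using eq x0 x1(1) x2(1) unfolding f(1,2) by simp_all
    then have 0: "(x0$1) *\<^sub>R P + (x0$2) *\<^sub>R Q + R = 0" "(x1$1) *\<^sub>R P + (x1$2) *\<^sub>R Q + R = 0"
      "(x2$1) *\<^sub>R P + (x2$2) *\<^sub>R Q + R = 0"
      using diff[OF x0] diff[OF x1(1)] diff[OF x2(1)] by simp_all
    have W: "(w$1) *\<^sub>R P + (w$2) *\<^sub>R Q = 0"
    proof -
      have "(w$1) *\<^sub>R P + (w$2) *\<^sub>R Q =
          ((x1$1) *\<^sub>R P + (x1$2) *\<^sub>R Q + R) - ((x0$1) *\<^sub>R P + (x0$2) *\<^sub>R Q + R)"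
        by (simp add: w_def algebra_simps)
      then show ?thesis unfolding 0 by simp
    qed
    have W': "(w'$1) *\<^sub>R P + (w'$2) *\<^sub>R Q = 0"
    proof -
      have "(w'$1) *\<^sub>R P + (w'$2) *\<^sub>R Q =
          ((x2$1) *\<^sub>R P + (x2$2) *\<^sub>R Q + R) - ((x0$1) *\<^sub>R P + (x0$2) *\<^sub>R Q + R)"
        by (simp add: w'_def algebra_simps)
      then show ?thesis unfolding 0 by simp
    qed
    have "cross2 w w' *\<^sub>R P = (w'$2) *\<^sub>R ((w$1) *\<^sub>R P + (w$2) *\<^sub>R Q) - (w$2) *\<^sub>R ((w'$1) *\<^sub>R P + (w'$2) *\<^sub>R Q)"
      "cross2 w w' *\<^sub>R Q = (w$1) *\<^sub>R ((w'$1) *\<^sub>R P + (w'$2) *\<^sub>R Q) - (w'$1) *\<^sub>R ((w$1) *\<^sub>R P + (w$2) *\<^sub>R Q)"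
      by (simp_all add: cross2_def algebra_simps)
    then have "P = 0" "Q = 0" unfolding W W' using x2(2) by (auto simp: w'_def)
    moreover from this 0(1) have "R = 0" by simp
    ultimately have "f x = f' x" if "x \<in> V" for x using diff[OF that] by simp
    then show "h = h'" unfolding f(1,2) by (rule restrict_ext)
  qed
  moreover have "?e ` ?H \<subseteq> V \<times> V \<times> V"
  proof (rule image_subsetI)
    fix h assume "h \<in> ?H"
    then obtain f where "h = restrict f V" "f \<in> V \<rightarrow> V" by blast
    then show "?e h \<in> V \<times> V \<times> V" using x0 x1(1) x2(1) by (simp add: Pi_iff)
  qed
  then have "countable (?e ` ?H)"
    by (rule countable_subset) (intro countable_SIGMA V)
  ultimately show ?thesis by (rule countable_image_inj_on[rotated])
qed

section \<open>The alternative between boxes and affine maps\<close>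

context plane_norm begin

text \<open>Gradients with P occur densely, and as supporting functionals they already cut out the
  unit ball. Having dual norm 1, parallel ones differ only by sign. So if only two directions occur,
  the ball is given by |c1 x| <= 1 and |c2 x| <= 1.\<close>

lemma box_or_three_gradients:
  assumes P: "\<And>W. open W \<Longrightarrow> W \<noteq> {} \<Longrightarrow> \<exists>x\<in>W. \<exists>c. has_grad x c \<and> P c"
  obtains c1 c2 where "cross2 c1 c2 \<noteq> 0" "\<And>x. N x = max \<bar>c1 \<bullet> x\<bar> \<bar>c2 \<bullet> x\<bar>"
  | c1 c2 c3 where "P c1" "P c2" "P c3" "cross2 c1 c2 \<noteq> 0" "cross2 c1 c3 \<noteq> 0" "cross2 c2 c3 \<noteq> 0"
proof -
  define S where "S = {c. P c \<and> (\<exists>x. x \<noteq> 0 \<and> has_grad x c)}"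
  have S_le: "\<bar>c \<bullet> y\<bar> \<le> N y" if "c \<in> S" for c y
    using that has_grad_abs_inner_le unfolding S_def by blast
  have S_eq: "\<exists>x. x \<noteq> 0 \<and> c \<bullet> x = N x" if "c \<in> S" for c
    using that has_grad_inner_self unfolding S_def by blast
  have par: "c' = c \<or> c' = - c" if cc: "c \<in> S" "c' \<in> S" "cross2 c c' = 0" for c c'
  proof -
    obtain x where x: "x \<noteq> 0" "c \<bullet> x = N x" using S_eq[OF cc(1)] by blast
    obtain y where y: "y \<noteq> 0" "c' \<bullet> y = N y" using S_eq[OF cc(2)] by blast
    have "c \<noteq> 0" "c' \<noteq> 0" using x y by auto
    then obtain k where k: "c' = k *\<^sub>R c"
      using cross2_eq_0E[OF cc(3)] by blast
    have "\<bar>k\<bar> * N x \<le> 1 * N x" using S_le[OF cc(2), of x] x(2) by (simp add: k abs_mult)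
    moreover have "1 * N y \<le> \<bar>k\<bar> * N y"
    proof -
      have "N y = \<bar>k\<bar> * \<bar>c \<bullet> y\<bar>" using y(2) nonneg[of y] by (simp add: k flip: abs_mult)
      also have "\<dots> \<le> \<bar>k\<bar> * N y" by (intro mult_left_mono S_le cc) auto
      finally show ?thesis by simp
    qed
    ultimately have "\<bar>k\<bar> \<le> 1" "1 \<le> \<bar>k\<bar>"
      using mult_right_le_imp_le[of "\<bar>k\<bar>" "N x" 1] mult_right_le_imp_le[of 1 "N y" "\<bar>k\<bar>"] x(1) y(1)
      by simp_all
    then have "k = 1 \<or> k = -1" by linarith
    then show ?thesis using k by auto
  qed
  have sep: "\<exists>c\<in>S. 1 < c \<bullet> y" if "1 < N y" for y
  proof -
    \<comment> \<open>With this radius, c y >= N x - N (x - y) >= N y - 2 N (x - y) > 1 for the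
      gradient c at x.\<close>
    let ?r = "(N y - 1) / 2"
    have "y \<in> {z. N (z - y) < ?r}" using that by simp
    then obtain x c where x: "N (x - y) < ?r" "has_grad x c" "P c"
      using P[OF open_ball[of y ?r]] by blast
    have Nx: "N y \<le> N x + N (x - y)" using triangle_diff[of y 0 x] by (simp add: minus_commute)
    then have "x \<noteq> 0" using x(1) that by auto
    then have "c \<in> S" using x by (auto simp: S_def)
    moreover have "1 < c \<bullet> y"
      using has_grad_inner_self[OF x(2)] has_grad_inner_le[OF x(2), of "x - y"] Nx x(1)
      by (simp add: inner_diff_right field_simps)
    ultimately show ?thesis by blast
  qed
  have large: "\<exists>r. 1 < N (r *\<^sub>R y)" if "y \<noteq> 0" for y
    using that by (intro exI[of _ "2 / N y"]) (simp add: scale)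
  obtain c1 where c1: "c1 \<in> S"
    using large[of "vector [1, 0]"] sep by (auto simp: vec_eq_real2)
  obtain c2 where c2: "c2 \<in> S" "cross2 c1 c2 \<noteq> 0"
  proof -
    have "c1 \<noteq> 0" using S_eq[OF c1] by auto
    \<comment> \<open>c1 turned by a right angle: a functional that does not vanish there is not
      parallel to c1.\<close>
    then have "vector [- c1$2, c1$1] \<noteq> (0::real^2)" by (auto simp: vec_eq_real2)
    then obtain r where "1 < N (r *\<^sub>R vector [- c1$2, c1$1])" using large by blast
    then obtain c where c: "c \<in> S" "1 < c \<bullet> (r *\<^sub>R vector [- c1$2, c1$1])" using sep by blast
    moreover have "c \<bullet> vector [- c1$2, c1$1] = cross2 c1 c" by (simp add: inner_real2 cross2_def)
    ultimately show thesis using that[of c] by fastforce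
  qed
  show ?thesis
  proof (cases "\<exists>c3\<in>S. cross2 c1 c3 \<noteq> 0 \<and> cross2 c2 c3 \<noteq> 0")
    case True
    then show ?thesis using that(2) c1 c2 by (auto simp: S_def)
  next
    case False
    have "N x \<le> 1 \<longleftrightarrow> max \<bar>c1 \<bullet> x\<bar> \<bar>c2 \<bullet> x\<bar> \<le> 1" for x
    proof
      assume "N x \<le> 1"
      then show "max \<bar>c1 \<bullet> x\<bar> \<bar>c2 \<bullet> x\<bar> \<le> 1"
        using S_le[OF c1, of x] S_le[OF c2(1), of x] by auto
    next
      assume *: "max \<bar>c1 \<bullet> x\<bar> \<bar>c2 \<bullet> x\<bar> \<le> 1"
      show "N x \<le> 1"
      proof (rule ccontr)
        assume "\<not> N x \<le> 1"
        then obtain c where c: "c \<in> S" "1 < c \<bullet> x" using sep[of x] by auto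
        then have "c = c1 \<or> c = - c1 \<or> c = c2 \<or> c = - c2"
          using False par[OF c1 c(1)] par[OF c2(1) c(1)] by blast
        then show False using c(2) * by auto
      qed
    qed
    then have "N x = max \<bar>c1 \<bullet> x\<bar> \<bar>c2 \<bullet> x\<bar>" for x
      by (intro is_norm_eqI[OF is_norm is_norm_max_abs[OF c2(2)]])
    then show ?thesis using that(1) c2(2) by blast
  qed
qed

text \<open>By existential closedness, u and v with N (u - v) < k are joined by a walk of k edges,
  and the k image edges have length < 1 each. The induction starts at 2 because an intermediate
  vertex must be free to choose; for k = 1 the pair itself may be a nonedge.\<close>

lemma iso_contracts_distance:
  assumes gec: "gec (\<lambda>x y. N (x - y)) V E1" and E2: "E2 \<subseteq> close_pairs (\<lambda>x y. N (x - y)) V"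
    and f: "\<And>u. u \<in> V \<Longrightarrow> f u \<in> V" "\<And>u v. \<lbrakk>u \<in> V; v \<in> V; {u, v} \<in> E1\<rbrakk> \<Longrightarrow> {f u, f v} \<in> E2"
    and k: "2 \<le> k" and uv: "u \<in> V" "v \<in> V" "N (u - v) < real k"
  shows "N (f u - f v) < real k"
proof -
  have edge: "N (f a - f b) < 1" if "a \<in> V" "b \<in> V" "{a, b} \<in> E1" for a b
  proof -
    have "{f a, f b} \<in> close_pairs (\<lambda>x y. N (x - y)) V" using f(2)[OF that] E2 by blast
    then obtain x y where "{f a, f b} = {x, y}" "N (x - y) < 1" by (auto simp: close_pairs_def)
    then show ?thesis using minus_commute[of x y] unfolding doubleton_eq_iff by (elim disjE conjE) simp_all
  qed
  have between: "\<exists>z\<in>W \<inter> V. \<forall>a\<in>A. {z, a} \<in> E1"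
    if A: "finite A" "A \<subseteq> V" and W: "open W" "m \<in> W" and "\<forall>z\<in>W. \<forall>a\<in>A. N (z - a) < 1" for A W m
  proof -
    have "W \<noteq> {}" using W(2) by blast
    have "\<exists>z\<in>W \<inter> V. z \<notin> A \<union> {} \<and> (\<forall>a\<in>A. {z, a} \<in> E1) \<and> (\<forall>b\<in>{}. {z, b} \<notin> E1)"
      by (rule gec[unfolded gec_def, rule_format]) (use that \<open>W \<noteq> {}\<close> in simp_all)
    then show ?thesis by blast
  qed
  have point: "\<exists>z. N (z - u) < 1 \<and> N (z - v) < real k" if "N (u - v) < real k + 1" "k > 0" for u v and k :: nat
  proof -
    \<comment> \<open>The point dividing the segment from u to v in the ratio 1 : k.\<close>
    define t where "t = 1 / (real k + 1)"
    have t: "0 < t" "1 - t > 0" "t * (real k + 1) = 1" "(1 - t) * (real k + 1) = real k"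
      using that(2) by (simp_all add: t_def field_simps)
    have "(u + t *\<^sub>R (v - u)) - v = (1 - t) *\<^sub>R (u - v)" "(u + t *\<^sub>R (v - u)) - u = t *\<^sub>R (v - u)"
      by (simp_all add: algebra_simps)
    then have "N ((u + t *\<^sub>R (v - u)) - v) = (1 - t) * N (u - v)"
      "N ((u + t *\<^sub>R (v - u)) - u) = t * N (u - v)"
      using t by (simp_all add: scale minus_commute[of v u])
    moreover have "(1 - t) * N (u - v) < (1 - t) * (real k + 1)" "t * N (u - v) < t * (real k + 1)"
      using mult_strict_left_mono[OF that(1) t(2)] mult_strict_left_mono[OF that(1) t(1)] by simp_all
    ultimately show ?thesis
      unfolding t(3,4) by (intro exI[of _ "u + t *\<^sub>R (v - u)"]) simp
  qed
  show ?thesis using k uv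
  proof (induction k arbitrary: u v rule: nat_induct_at_least)
    case base
    obtain z0 where "N (z0 - u) < 1" "N (z0 - v) < 1" using point[of u v 1] base by auto
    then have "\<exists>z\<in>({z. N (z - u) < 1} \<inter> {z. N (z - v) < 1}) \<inter> V. \<forall>a\<in>{u, v}. {z, a} \<in> E1"
      using base by (intro between[where m = z0] open_Int open_ball) auto
    then obtain z where z: "z \<in> V" "{z, u} \<in> E1" "{z, v} \<in> E1" by blast
    have "N (f u - f v) \<le> N (f u - f z) + N (f z - f v)" by (rule triangle_diff)
    also have "N (f u - f z) = N (f z - f u)" by (rule minus_commute)
    finally show ?case using edge[OF z(1) base(1) z(2)] edge[OF z(1) base(2) z(3)] by simp
  next
    case (Suc k)
    obtain z0 where "N (z0 - u) < 1" "N (z0 - v) < real k" using point[of u v k] Suc by auto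
    then have "\<exists>z\<in>({z. N (z - u) < 1} \<inter> {z. N (z - v) < real k}) \<inter> V. \<forall>a\<in>{u}. {z, a} \<in> E1"
      using Suc.prems by (intro between[where m = z0] open_Int open_ball) auto
    then obtain z where z: "z \<in> V" "{z, u} \<in> E1" "N (z - v) < real k" by blast
    have "N (f u - f v) \<le> N (f u - f z) + N (f z - f v)" by (rule triangle_diff)
    also have "N (f u - f z) = N (f z - f u)" by (rule minus_commute)
    finally show ?case
      using edge[OF z(1) Suc.prems(1) z(2)] Suc.IH[OF z(1) Suc.prems(2) z(3)] by simp
  qed
qed

end

lemma (in step_isometry) box_or_affine:
  obtains c1 c2 where "cross2 c1 c2 \<noteq> 0" "\<And>x. N x = max \<bar>c1 \<bullet> x\<bar> \<bar>c2 \<bullet> x\<bar>"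
  | "affine_on V f"
proof -
  obtain H U where H: "H \<noteq> bot" "H \<le> sequentially" and lim: "\<And>u. ((\<lambda>n. F n u) \<longlongrightarrow> U u) H"
    and iso: "\<And>u v. N (U u - U v) = N (u - v)"
  proof (rule asymptotic_isometry)
    fix H U assume "H \<noteq> bot" "H \<le> sequentially" "\<And>u. ((\<lambda>n. F n u) \<longlongrightarrow> U u) H"
      "\<And>u v. N (U u - U v) = N (u - v)"
    then show thesis by (rule that)
  qed
  have "U 0 = 0"
  proof (rule tendsto_unique[OF H(1) lim])
    have "(\<lambda>n. (1 / real n) *\<^sub>R f (rnd 0)) \<longlonglongrightarrow> 0 *\<^sub>R f (rnd 0)"
      by (intro tendsto_intros lim_1_over_n)
    then show "((\<lambda>n. F n 0) \<longlongrightarrow> 0) H" using H(2) by (auto simp: F_def intro: tendsto_mono)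
  qed
  then have NU: "N (U u) = N u" for u using iso[of u 0] by simp
  \<comment> \<open>U is injective and preserves N, so the unit vectors whose images have no
    gradient are countably many too.\<close>
  define Bad where "Bad = {u. N u = 1 \<and> ((\<nexists>c. has_grad u c) \<or> (\<nexists>e. has_grad (U u) e))}"
  have "countable Bad"
  proof (rule countable_subset)
    let ?A = "{x. N x = 1 \<and> (\<nexists>c. has_grad x c)}"
    let ?B = "{u. N u = 1 \<and> (\<nexists>e. has_grad (U u) e)}"
    show "Bad \<subseteq> ?A \<union> ?B" by (auto simp: Bad_def)
    have "inj_on U ?B"
    proof (rule inj_onI)
      show "u = v" if "U u = U v" for u v using iso[of u v] that by simp
    qed
    moreover have "U ` ?B \<subseteq> ?A" by (auto simp: NU)
    then have "countable (U ` ?B)" using countable_unit_no_grad by (rule countable_subset)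
    ultimately have "countable ?B" by (rule countable_image_inj_on[rotated])
    then show "countable (?A \<union> ?B)" using countable_unit_no_grad by simp
  qed
  define T where "T = (\<lambda>u. u$1 / u$2) ` Bad"
  have T: "countable T" using \<open>countable Bad\<close> by (simp add: T_def)
  have good: "\<exists>x\<in>W. \<exists>c. has_grad x c \<and> (\<exists>e. e \<noteq> 0 \<and> order_preserving V f c e)"
    if W: "open W" "W \<noteq> {}" for W
  proof -
    \<comment> \<open>\<open>L t\<close> is the line of direction \<open>vector [t, 1]\<close>. The
      exceptional lines are countably many null sets, so they do not cover W.\<close>
    define L where "L t = {x::real^2. vector [1, - t] \<bullet> x = 0}" for t :: real
    define L' where "L' = {x::real^2. vector [0, 1] \<bullet> x = 0}"
    have "negligible (L t)" "negligible L'" for t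
      unfolding L_def L'_def by (rule negligible_hyperplane, simp add: vec_eq_real2)+
    then have "negligible (L' \<union> \<Union>(L ` T))"
      using T by (intro negligible_Un negligible_countable_Union countable_image) auto
    then have "\<not> W \<subseteq> L' \<union> \<Union>(L ` T)"
      using open_not_negligible[OF W] negligible_subset by blast
    then obtain x where x: "x \<in> W" "x \<notin> L'" "\<And>t. t \<in> T \<Longrightarrow> x \<notin> L t" by blast
    have x2: "x$2 \<noteq> 0" using x(2) by (simp add: L'_def inner_real2)
    have "x$1 / x$2 \<notin> T"
    proof
      assume "x$1 / x$2 \<in> T"
      from x(3)[OF this] show False using x2 by (simp add: L_def inner_real2)
    qed
    note x = x(1) x2 this
    have "x \<noteq> 0" using x(2) by auto
    define u where "u = (1 / N x) *\<^sub>R x"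
    have u: "N u = 1" "u$1 / u$2 = x$1 / x$2" using \<open>x \<noteq> 0\<close> by (simp_all add: u_def scale)
    have "u \<notin> Bad"
    proof
      assume "u \<in> Bad"
      then have "u$1 / u$2 \<in> T" unfolding T_def by (rule imageI)
      then show False using x(3) u(2) by simp
    qed
    then obtain c e where c: "has_grad u c" and e: "has_grad (U u) e" using u(1) by (auto simp: Bad_def)
    have "x = N x *\<^sub>R u" using \<open>x \<noteq> 0\<close> by (simp add: u_def)
    then have "has_grad x c" using has_grad_scale[OF c, of "N x"] \<open>x \<noteq> 0\<close> by simp
    moreover have "e \<noteq> 0" using has_grad_inner_self[OF e] u(1) by (auto simp: NU)
    moreover have "order_preserving V f c e"
      unfolding order_preserving_def
      using asymptotic_order[OF u(1) c e H lim] by blast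
    ultimately show ?thesis using x(1) by blast
  qed
  from good show ?thesis
  proof (rule box_or_three_gradients)
    show ?thesis if "cross2 c1 c2 \<noteq> 0" "\<And>x. N x = max \<bar>c1 \<bullet> x\<bar> \<bar>c2 \<bullet> x\<bar>" for c1 c2
      using \<open>\<And>c1 c2. \<lbrakk>cross2 c1 c2 \<noteq> 0; \<And>x. N x = max \<bar>c1 \<bullet> x\<bar> \<bar>c2 \<bullet> x\<bar>\<rbrakk> \<Longrightarrow> thesis\<close> that by blast
    show ?thesis if "\<exists>e. e \<noteq> 0 \<and> order_preserving V f c1 e" "\<exists>e. e \<noteq> 0 \<and> order_preserving V f c2 e"
      "\<exists>e. e \<noteq> 0 \<and> order_preserving V f c3 e" "cross2 c1 c2 \<noteq> 0" "cross2 c1 c3 \<noteq> 0" "cross2 c2 c3 \<noteq> 0"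
      for c1 c2 c3
      using affine_on_if_order_preserving[OF dense _ _ _ _ that(4-6)] that(1-3)
        \<open>affine_on V f \<Longrightarrow> thesis\<close> by blast
  qed
qed

lemma box_metricI:
  assumes d: "norm_derived d" "\<And>x. d x 0 = max \<bar>c1 \<bullet> x\<bar> \<bar>c2 \<bullet> x\<bar>" and c: "cross2 c1 c2 \<noteq> 0"
  shows "box_metric d"
proof -
  obtain u where u: "c1 \<bullet> u = 2" "c2 \<bullet> u = 0" using cross2_nonzeroE[OF c] by metis
  obtain v where v: "c1 \<bullet> v = 0" "c2 \<bullet> v = 2" using cross2_nonzeroE[OF c] by metis
  obtain a where a: "c1 \<bullet> a = -1" "c2 \<bullet> a = -1" using cross2_nonzeroE[OF c] by metis
  have "\<not> collinear {0, u, v}"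
    unfolding collinear_lemma using u v by auto
  moreover have "shape d = convex hull {a, a + u, a + u + v, a + v}"
    unfolding parallelogram_convex_hull shape_def d(2)
  proof (intro equalityI subsetI)
    fix x assume x: "x \<in> {x. max \<bar>c1 \<bullet> x\<bar> \<bar>c2 \<bullet> x\<bar> \<le> 1}"
    have "x = a + ((c1 \<bullet> x + 1) / 2) *\<^sub>R u + ((c2 \<bullet> x + 1) / 2) *\<^sub>R v"
      by (rule cross2_inner_inj[OF c]) (simp_all add: inner_add_right u v a field_simps)
    moreover have "(c1 \<bullet> x + 1) / 2 \<in> {0..1}" "(c2 \<bullet> x + 1) / 2 \<in> {0..1}" using x by auto
    ultimately show "x \<in> {a + s *\<^sub>R u + t *\<^sub>R v |s t. s \<in> {0..1} \<and> t \<in> {0..1}}" by blast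
  qed (auto simp: inner_add_right u v a)
  ultimately show ?thesis using d(1) unfolding box_metric_def parallelogram_def by blast
qed

lemma (in plane_norm) infinite_close_pairs:
  assumes V: "closure V = UNIV"
  shows "infinite (close_pairs (\<lambda>x y. N (x - y)) V)"
proof
  assume fin: "finite (close_pairs (\<lambda>x y. N (x - y)) V)"
  obtain v where v: "v \<in> V" using dense_meets_open[OF V open_UNIV] by auto
  let ?S = "{z. N (z - v) < 1} \<inter> V - {v}"
  have "v \<in> {z. N (z - v) < 1}" by simp
  then have "infinite ({z. N (z - v) < 1} \<inter> V)"
    by (intro infinite_dense_inter_open[OF V open_ball]) blast
  then have "infinite ?S" by (rule infinite_remove)
  moreover have "(\<lambda>z. {z, v}) ` ?S \<subseteq> close_pairs (\<lambda>x y. N (x - y)) V"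
    using v by (auto intro!: close_pairsI)
  then have "finite ((\<lambda>z. {z, v}) ` ?S)" using fin by (rule finite_subset)
  moreover have "inj_on (\<lambda>z. {z, v}) ?S" by (auto simp: inj_on_def doubleton_eq_iff)
  ultimately show False using finite_imageD by blast
qed

lemma predictable_imp_box_metric:
  assumes "norm_derived d" "predictable d"
  shows "box_metric d"
proof (rule ccontr)
  assume nbox: "\<not> box_metric d"
  obtain N where "is_norm N" and "\<And>x y. d x y = N (x - y)"
    using assms(1) by (auto simp: norm_derived_def)
  then have d: "d = (\<lambda>x y. N (x - y))" by (simp add: fun_eq_iff)
  interpret plane_norm N by unfold_locales fact
  obtain V where V: "countable V" "closure V = UNIV" and pred: "\<forall>p\<in>{0<..<1}.
      AE (\<omega>1, \<omega>2) in larg d V p \<Otimes>\<^sub>M larg d V p. graph_isomorphic (larg_graph d V \<omega>1) (larg_graph d V \<omega>2)"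
    using assms(2) by (auto simp: predictable_def)
  let ?M = "larg d V (1 / 2)"
  let ?E = "\<lambda>\<omega>. snd (larg_graph d V \<omega>)"
  interpret M: prob_space ?M by (rule prob_space_larg)
  interpret MM: pair_prob_space ?M ?M ..
  have "AE z in ?M \<Otimes>\<^sub>M ?M. graph_isomorphic (larg_graph d V (fst z)) (larg_graph d V (snd z))"
    using bspec[OF pred, of "1 / 2"] by (simp add: case_prod_unfold)
  from MM.AE_pair[OF this]
  have "AE \<omega>1 in ?M. AE \<omega>2 in ?M. graph_isomorphic (larg_graph d V \<omega>1) (larg_graph d V \<omega>2)" by simp
  moreover have gec: "AE \<omega> in ?M. gec d V (?E \<omega>)" by (rule AE_larg_gec) (use V in auto)
  ultimately have "AE \<omega>1 in ?M. gec d V (?E \<omega>1) \<and>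
      (AE \<omega>2 in ?M. graph_isomorphic (larg_graph d V \<omega>1) (larg_graph d V \<omega>2))"
    by eventually_elim simp
  \<comment> \<open>One good sample is fixed by Fubini's theorem; from here on only the second graph
    is random.\<close>
  then obtain \<omega>1 where gec1: "gec d V (?E \<omega>1)" and
    iso: "AE \<omega>2 in ?M. graph_isomorphic (larg_graph d V \<omega>1) (larg_graph d V \<omega>2)"
    using eventually_happens[of _ "ae_filter ?M"] M.ae_filter_bot by blast
  define \<H> where "\<H> = {restrict f V | f. f \<in> V \<rightarrow> V \<and> affine_on V f} \<inter> {h. bij_betw h V V}"
  have "countable \<H>" unfolding \<H>_def using countable_affine_maps[OF V] by blast
  moreover have "AE \<omega>2 in ?M. \<not> (\<forall>u\<in>V. \<forall>v\<in>V. {u, v} \<in> ?E \<omega>1 \<longleftrightarrow> {h u, h v} \<in> ?E \<omega>2)" if "h \<in> \<H>" for h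
    by (rule AE_larg_not_iso_via) (use that infinite_close_pairs[OF V(2)] in \<open>auto simp: \<H>_def d\<close>)
  ultimately have no: "AE \<omega>2 in ?M. \<forall>h\<in>\<H>. \<not> (\<forall>u\<in>V. \<forall>v\<in>V. {u, v} \<in> ?E \<omega>1 \<longleftrightarrow> {h u, h v} \<in> ?E \<omega>2)"
    by (subst AE_ball_countable) auto
  have "AE \<omega>2 in ?M. False"
    using iso gec no
  proof eventually_elim
    case (elim \<omega>2)
    have E: "?E \<omega> \<subseteq> close_pairs d V" for \<omega> by (auto simp: larg_graph_def)
    obtain f where f: "bij_betw f V V" "\<And>u v. \<lbrakk>u \<in> V; v \<in> V\<rbrakk> \<Longrightarrow> {u, v} \<in> ?E \<omega>1 \<longleftrightarrow> {f u, f v} \<in> ?E \<omega>2"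
      using elim(1) by (auto simp: graph_isomorphic_def larg_graph_def)
    define g where "g = inv_into V f"
    have fV: "f u \<in> V" if "u \<in> V" for u using f(1) that by (auto simp: bij_betw_def)
    have gV: "g u \<in> V" "f (g u) = u" if "u \<in> V" for u
      using f(1) that unfolding g_def by (auto simp: bij_betw_def inv_into_into f_inv_into_f)
    have gf: "g (f u) = u" if "u \<in> V" for u
      using f(1) that unfolding g_def by (simp add: bij_betw_inv_into_left)
    define E1 where "E1 = ?E \<omega>1"
    define E2 where "E2 = ?E \<omega>2"
    have gecs: "gec (\<lambda>x y. N (x - y)) V E1" "gec (\<lambda>x y. N (x - y)) V E2"
      using gec1 elim(2) by (simp_all add: E1_def E2_def d)
    have subs: "E1 \<subseteq> close_pairs (\<lambda>x y. N (x - y)) V" "E2 \<subseteq> close_pairs (\<lambda>x y. N (x - y)) V"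
      using E[of \<omega>1] E[of \<omega>2] by (simp_all add: E1_def E2_def d)
    have fE: "{f u, f v} \<in> E2" if "u \<in> V" "v \<in> V" "{u, v} \<in> E1" for u v
      using f(2)[OF that(1,2)] that(3) by (simp add: E1_def E2_def)
    have gE: "{g u, g v} \<in> E1" if "u \<in> V" "v \<in> V" "{u, v} \<in> E2" for u v
      using f(2)[OF gV(1) gV(1), OF that(1,2)] gV(2) that by (simp add: E1_def E2_def)
    \<comment> \<open>Contraction of distances under f gives one implication, under its inverse g
      the other.\<close>
    interpret step_isometry N V f
    proof
      show "f x \<in> V" if "x \<in> V" for x using fV[OF that] .
      fix x y and k :: int assume xy: "x \<in> V" "y \<in> V" and k: "2 \<le> k"
      have k': "2 \<le> nat k" "real (nat k) = of_int k" using k by auto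
      show "N (f x - f y) < of_int k \<longleftrightarrow> N (x - y) < of_int k"
      proof
        assume "N (x - y) < of_int k"
        from iso_contracts_distance[where f = f, OF gecs(1) subs(2) fV fE k'(1) xy, unfolded k'(2), OF _ _ _ _ this]
        show "N (f x - f y) < of_int k" by simp
      next
        assume "N (f x - f y) < of_int k"
        from iso_contracts_distance[where f = g, OF gecs(2) subs(1) gV(1) gE k'(1) fV[OF xy(1)] fV[OF xy(2)],
            unfolded k'(2), OF _ _ _ _ this]
        show "N (x - y) < of_int k" by (simp add: gf xy)
      qed
    qed fact
    show False
    proof (rule box_or_affine)
      show False if "cross2 c1 c2 \<noteq> 0" "\<And>x. N x = max \<bar>c1 \<bullet> x\<bar> \<bar>c2 \<bullet> x\<bar>" for c1 c2
        using box_metricI[OF assms(1) _ that(1)] that(2) nbox by (simp add: d)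
      assume "affine_on V f"
      then have "restrict f V \<in> \<H>"
        using f(1) fV bij_betw_cong[of V "restrict f V" f V] unfolding \<H>_def by auto
      from bspec[OF elim(3) this] f(2) show False by simp
    qed
  qed
  then show False by simp
qed

theorem theorem4:
  fixes d :: "real^2 \<Rightarrow> real^2 \<Rightarrow> real"
  assumes "d \<in> Omega"
  shows "predictable d \<longleftrightarrow> box_metric d"
  using assms box_metric_predictable predictable_imp_box_metric by (auto simp: Omega_def)

end
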